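(* Let $\mu,\nu$ be probability measures on $\mathcal{X}$ with $\mu\ll\nu$. Then $\lim_{n\to\infty}E^\mu[\|\pi_n^\mu-\pi_n^\nu\|_{TV}]=0$ if and only if $\lim_{n\to\infty}E^\mu[\|\pi_{n-}^\mu-\pi_{n-}^\nu\|_{TV}]=0$.
   Context: Setting: $\mathcal{X},\mathcal{Y},\mathcal{Z}$ are Polish spaces. $T$ is a transition kernel on $\mathcal{X}$; $\{Z_n\}$ is i.i.d. with law $Q$, independent of the states; $h:\mathcal{X}\times\mathcal{Z}\to\mathcal{Y}$ measurable. $\{X_n\}$ is a Markov chain with kernel $T$, $X_0\sim\mu$, $Y_n=h(X_n,Z_n)$; $P^\mu$, $E^\mu$ are the joint law and expectation. Predictor $\pi_{n-}^{\mu}=P^{\mu}(X_n\in\cdot\mid Y_0,\dots,Y_{n-1})$; filter $\pi_n^{\mu}=P^{\mu}(X_n\in\cdot\mid Y_0,\dots,Y_n)$. Total variation: $\|P-R\|_{TV}=\sup_{\|f\|_\infty\le1}|\int f\,dP-\int f\,dR|$ over measurable $f$. *)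

theory Defs
  imports "HOL-Probability.Probability"
begin

definition tv_dist :: "'a measure \<Rightarrow> 'a measure \<Rightarrow> real" where
  "tv_dist P R = (SUP f \<in> {f. f \<in> borel_measurable P \<and> (\<forall>x. \<bar>f x\<bar> \<le> 1)}.
      \<bar>(\<integral>x. f x \<partial>P) - (\<integral>x. f x \<partial>R)\<bar>)"

definition hmm_model :: "'w measure \<Rightarrow> 'x::polish_space measure \<Rightarrow> ('x \<Rightarrow> 'x measure)
    \<Rightarrow> 'z::polish_space measure \<Rightarrow> (nat \<Rightarrow> 'w \<Rightarrow> 'x) \<Rightarrow> (nat \<Rightarrow> 'w \<Rightarrow> 'z) \<Rightarrow> bool" where
  "hmm_model P \<mu> T Q X Z \<longleftrightarrow>
     prob_space P \<and>
     (\<forall>n. X n \<in> P \<rightarrow>\<^sub>M borel) \<and> (\<forall>n. Z n \<in> P \<rightarrow>\<^sub>M borel) \<and>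
     distr P borel (X 0) = \<mu> \<and>
     (\<forall>n A B. A \<in> sets borel \<longrightarrow> B \<in> sets (PiM {..n} (\<lambda>_. borel)) \<longrightarrow>
        emeasure P {\<omega> \<in> space P. (\<lambda>i\<in>{..n}. X i \<omega>) \<in> B \<and> X (Suc n) \<omega> \<in> A}
        = (\<integral>\<^sup>+\<omega>. indicator B (\<lambda>i\<in>{..n}. X i \<omega>) * emeasure (T (X n \<omega>)) A \<partial>P)) \<and>
     (\<forall>n. distr P borel (Z n) = Q) \<and>
     prob_space.indep_vars P (\<lambda>_. borel) Z UNIV \<and>
     distr P (PiM UNIV (\<lambda>_. borel) \<Otimes>\<^sub>M PiM UNIV (\<lambda>_. borel)) (\<lambda>\<omega>. (\<lambda>n. X n \<omega>, \<lambda>n. Z n \<omega>))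
       = distr P (PiM UNIV (\<lambda>_. borel)) (\<lambda>\<omega> n. X n \<omega>) \<Otimes>\<^sub>M distr P (PiM UNIV (\<lambda>_. borel)) (\<lambda>\<omega> n. Z n \<omega>)"

text \<open>K is a version of the regular conditional distribution P(X n \<in> . | Y i, i \<in> I),
  written as a measurable kernel of the observation vector (Y i)_{i \<in> I}.\<close>
definition is_rcd :: "'w measure \<Rightarrow> (nat \<Rightarrow> 'w \<Rightarrow> 'x::topological_space) \<Rightarrow> (nat \<Rightarrow> 'w \<Rightarrow> 'y::topological_space)
    \<Rightarrow> nat \<Rightarrow> nat set \<Rightarrow> ((nat \<Rightarrow> 'y) \<Rightarrow> 'x measure) \<Rightarrow> bool" where
  "is_rcd P X Y n I K \<longleftrightarrow>
     K \<in> PiM I (\<lambda>_. borel) \<rightarrow>\<^sub>M prob_algebra borel \<and>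
     (\<forall>A \<in> sets borel. \<forall>B \<in> sets (PiM I (\<lambda>_. borel)).
        emeasure P {\<omega> \<in> space P. X n \<omega> \<in> A \<and> (\<lambda>i\<in>I. Y i \<omega>) \<in> B}
        = (\<integral>\<^sup>+\<omega>. indicator B (\<lambda>i\<in>I. Y i \<omega>) * emeasure (K (\<lambda>i\<in>I. Y i \<omega>)) A \<partial>P))"

end

theory Submission
  imports Defs
begin

text \<open>
  Let \<open>\<Lambda>\<close> be the density of \<open>\<mu>\<close> with respect to \<open>\<nu>\<close>. The joint laws of the chain and the noise under the
  two models differ only by the factor \<open>\<Lambda> (X\<^sub>0)\<close>. Conditional laws of \<open>X\<^sub>n\<close> given an observation vector \<open>U\<close>
  therefore satisfy
  \<open>E\<^sup>\<mu> \<parallel>P\<^sup>\<mu>(X\<^sub>n \<in> \<cdot> | U) - P\<^sup>\<nu>(X\<^sub>n \<in> \<cdot> | U)\<parallel> = E\<^sup>\<nu> \<bar>E\<^sup>\<nu>[\<Lambda> (X\<^sub>0) | X\<^sub>n, U] - E\<^sup>\<nu>[\<Lambda> (X\<^sub>0) | U]\<bar>\<close>.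
  Given \<open>X\<^sub>n\<close>, the observation \<open>Y\<^sub>n\<close> carries only independent noise, so the first conditional expectation is the
  same for the filter and for the predictor. The two quantities thus differ by at most
  \<open>E\<^sup>\<nu> \<bar>M\<^sub>n\<^sub>+\<^sub>1 - M\<^sub>n\<bar>\<close> with the closed martingale \<open>M\<^sub>n = E\<^sup>\<nu>[\<Lambda> (X\<^sub>0) | Y\<^sub>0, \<dots>, Y\<^sub>n\<^sub>-\<^sub>1]\<close>. This tends to \<open>0\<close>: for bounded
  \<open>\<Lambda>\<close> because the increments are orthogonal and \<open>E M\<^sub>n\<^sup>2\<close> increases to a finite limit, and in general by truncation.
\<close>

subsection \<open>Increments of closed martingales\<close>

text \<open>The identity for the distance of conditional laws is Bayes' rule. Let \<open>g\<close>
  and \<open>m\<close> be the densities of the \<mu>-laws of \<open>(X n, U)\<close> and of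
  \<open>U\<close> relative to the \<nu>-laws. Given \<open>U = u\<close>, the \<mu>-conditional law
  of \<open>X n\<close> has density \<open>g (x, u) / m u\<close> relative to the \<nu>-conditional
  law. Multiplying the distance by \<open>m u\<close> removes the quotient and at the same time
  turns an expectation under \<mu> into one under \<nu>. Three obstacles shape the details.
  \<open>P\<mu>\<close> and \<open>P\<nu>\<close> are related only through the laws of chain and
  noise, not on the sample space itself, so all densities are taken between image laws. Bayes' rule
  holds for each Borel set off a null set that depends on the set, so a countable generating family
  has to supply a common one. Finally, \<open>tv_dist\<close> is a supremum over uncountably many
  functions, and its measurability in \<open>u\<close> has to be established before it can be
  integrated.\<close>

lemma exists_real_density:
  assumes "sigma_finite_measure M" "finite_measure N" "absolutely_continuous M N" "sets N = sets M"
  obtains f :: "'a \<Rightarrow> real" where "f \<in> borel_measurable M" "\<And>x. 0 \<le> f x" "N = density M (\<lambda>x. ennreal (f x))"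
proof -
  interpret M: sigma_finite_measure M by fact
  interpret N: finite_measure N by fact
  have D: "density M (RN_deriv M N) = N"
    using M.density_RN_deriv[OF assms(3,4)] .
  have fin: "AE x in M. RN_deriv M N x \<noteq> \<infinity>"
    using M.RN_deriv_finite[OF N.sigma_finite_measure_axioms assms(3,4)] .
  show thesis
  proof (rule that[of "\<lambda>x. enn2real (RN_deriv M N x)"])
    have "density M (\<lambda>x. ennreal (enn2real (RN_deriv M N x))) = density M (RN_deriv M N)"
      by (rule density_cong) (use fin in \<open>auto simp: less_top[symmetric]\<close>)
    then show "N = density M (\<lambda>x. ennreal (enn2real (RN_deriv M N x)))"
      using D by simp
  qed auto
qed

text \<open>The variance of \<open>\<bar>f x\<bar>\<close> is non-negative. This carries the
  orthogonality argument for martingale increments from L2 over to L1.\<close>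

lemma (in prob_space) integral_abs_le_sqrt:
  fixes f :: "'a \<Rightarrow> real"
  assumes [measurable]: "f \<in> borel_measurable M" and i: "integrable M (\<lambda>x. (f x)\<^sup>2)"
  shows "(\<integral>x. \<bar>f x\<bar> \<partial>M) \<le> sqrt (\<integral>x. (f x)\<^sup>2 \<partial>M)"
proof -
  have f: "integrable M f"
    using square_integrable_imp_integrable[OF assms] .
  have "0 \<le> variance (\<lambda>x. \<bar>f x\<bar>)"
    by (intro integral_nonneg_AE) auto
  also have "\<dots> = (\<integral>x. (f x)\<^sup>2 \<partial>M) - (\<integral>x. \<bar>f x\<bar> \<partial>M)\<^sup>2"
    using f i by (subst variance_eq) auto
  finally show ?thesis
    by (intro real_le_rsqrt) simp
qed

text \<open>Monotonicity squeezes the conditional expectation of \<open>f\<close> between plus and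
  minus that of \<open>\<bar>f x\<bar>\<close>, whose integral is unchanged by conditioning. The
  bound does not involve \<open>F\<close>, so a truncation error is controlled uniformly along a
  filtration.\<close>

lemma (in finite_measure_subalgebra) real_cond_exp_L1_contraction:
  assumes f: "integrable M f"
  shows "(\<integral>x. \<bar>real_cond_exp M F f x\<bar> \<partial>M) \<le> (\<integral>x. \<bar>f x\<bar> \<partial>M)"
proof -
  have f': "integrable M (\<lambda>x. \<bar>f x\<bar>)" using f by simp
  have nf: "integrable M (\<lambda>x. - \<bar>f x\<bar>)" using f by simp
  have "AE x in M. real_cond_exp M F f x \<le> real_cond_exp M F (\<lambda>x. \<bar>f x\<bar>) x"
    using f f' by (intro real_cond_exp_mono) auto
  moreover have "AE x in M. real_cond_exp M F (\<lambda>x. - \<bar>f x\<bar>) x \<le> real_cond_exp M F f x"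
    using f nf by (intro real_cond_exp_mono) auto
  moreover have "AE x in M. real_cond_exp M F (\<lambda>x. - 1 * \<bar>f x\<bar>) x = - 1 * real_cond_exp M F (\<lambda>x. \<bar>f x\<bar>) x"
    using f' by (rule real_cond_exp_cmult)
  ultimately have "AE x in M. \<bar>real_cond_exp M F f x\<bar> \<le> real_cond_exp M F (\<lambda>x. \<bar>f x\<bar>) x"
    by eventually_elim auto
  then have "(\<integral>x. \<bar>real_cond_exp M F f x\<bar> \<partial>M) \<le> (\<integral>x. real_cond_exp M F (\<lambda>x. \<bar>f x\<bar>) x \<partial>M)"
    using f f' by (intro integral_mono_AE) (auto intro!: real_cond_exp_int)
  also have "\<dots> = (\<integral>x. \<bar>f x\<bar> \<partial>M)"
    using f' by (rule real_cond_exp_int)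
  finally show ?thesis .
qed

text \<open>Pythagoras: the squared L2 norm of an increment is \<open>e (Suc n) - e n\<close>, and
  \<open>e\<close> converges, being monotone and bounded by the square of \<open>c\<close>. Only the
  increments have to vanish, so no limit of the martingale itself is constructed.\<close>

lemma (in prob_space) bounded_martingale_increments:
  fixes f :: "'a \<Rightarrow> real"
  assumes sub: "\<And>n. subalgebra M (F n)"
    and mono: "\<And>n. sets (F n) \<subseteq> sets (F (Suc n))"
    and [measurable]: "f \<in> borel_measurable M" and bd: "\<And>x. \<bar>f x\<bar> \<le> c"
  shows "(\<lambda>n. \<integral>x. \<bar>real_cond_exp M (F (Suc n)) f x - real_cond_exp M (F n) f x\<bar> \<partial>M) \<longlonglongrightarrow> 0"
proof -
  define C where "C n = real_cond_exp M (F n) f" for n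
  have S: "finite_measure_subalgebra M (F n)" for n
    by (simp add: finite_measure_subalgebra_def finite_measure_subalgebra_axioms_def sub finite_measure_axioms)
  have fi: "integrable M f"
    by (rule integrable_const_bound[of _ c]) (auto simp: bd)
  have [measurable]: "C n \<in> borel_measurable (F n)" for n unfolding C_def by simp
  have [measurable]: "C n \<in> borel_measurable M" for n unfolding C_def by simp
  have Cb: "AE x in M. \<bar>C n x\<bar> \<le> c" for n
  proof -
    interpret finite_measure_subalgebra M "F n" by (rule S)
    have "- c \<le> f x" "f x \<le> c" for x using bd[of x] by auto
    then have "AE x in M. C n x \<le> c" "AE x in M. C n x \<ge> - c"
      unfolding C_def by (intro real_cond_exp_le_c real_cond_exp_ge_c fi AE_I2; simp)+
    then show ?thesis by eventually_elim auto
  qed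
  have c0: "0 \<le> c" using bd[of undefined] by linarith
  have Cb2: "AE x in M. norm (C n x * C m x) \<le> c * c" for n m
    using Cb[of n] Cb[of m] by eventually_elim (simp add: abs_mult mult_mono')
  have ii: "integrable M (\<lambda>x. C n x * C m x)" for n m
    by (rule integrable_const_bound[OF Cb2]) simp
  have Cf: "AE x in M. norm (C n x * f x) \<le> c * c" for n
    using Cb[of n] by eventually_elim (simp add: abs_mult mult_mono' bd)
  have if': "integrable M (\<lambda>x. C n x * f x)" for n
    by (rule integrable_const_bound[OF Cf]) simp
  \<comment> \<open>Both integrals equal that of \<open>C n x * f x\<close>: the factor
    \<open>C n\<close> is measurable for \<open>F n\<close> and, since the filtration increases, for
    \<open>F (Suc n)\<close>, so it can be moved inside either conditional expectation.\<close>
  have orth: "(\<integral>x. C n x * C (Suc n) x \<partial>M) = (\<integral>x. C n x * C n x \<partial>M)" for n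
  proof -
    interpret A: finite_measure_subalgebra M "F n" by (rule S)
    interpret B: finite_measure_subalgebra M "F (Suc n)" by (rule S)
    have "space (F n) = space (F (Suc n))" using sub unfolding subalgebra_def by metis
    then have "subalgebra (F (Suc n)) (F n)" using mono unfolding subalgebra_def by auto
    then have [measurable]: "C n \<in> borel_measurable (F (Suc n))"
      using measurable_from_subalg \<open>C n \<in> borel_measurable (F n)\<close> by blast
    have "(\<integral>x. C n x * C n x \<partial>M) = (\<integral>x. C n x * f x \<partial>M)"
      using A.real_cond_exp_intg(2)[OF if'[of n]] by (simp add: C_def)
    moreover have "(\<integral>x. C n x * C (Suc n) x \<partial>M) = (\<integral>x. C n x * f x \<partial>M)"
      using B.real_cond_exp_intg(2)[OF if'[of n]] unfolding C_def[of "Suc n"] by simp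
    ultimately show ?thesis by simp
  qed
  define e where "e n = (\<integral>x. (C n x)\<^sup>2 \<partial>M)" for n
  have incr: "(\<integral>x. (C (Suc n) x - C n x)\<^sup>2 \<partial>M) = e (Suc n) - e n" for n
  proof -
    have "(\<integral>x. (C (Suc n) x - C n x)\<^sup>2 \<partial>M)
      = (\<integral>x. C (Suc n) x * C (Suc n) x - 2 * (C n x * C (Suc n) x) + C n x * C n x \<partial>M)"
      by (intro Bochner_Integration.integral_cong) (auto simp: power2_eq_square algebra_simps)
    also have "\<dots> = e (Suc n) - 2 * (\<integral>x. C n x * C (Suc n) x \<partial>M) + e n"
      using ii by (simp add: e_def power2_eq_square)
    finally show ?thesis
      using orth[of n] by (simp add: e_def power2_eq_square)
  qed
  have iD: "integrable M (\<lambda>x. (C (Suc n) x - C n x)\<^sup>2)" for n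
  proof -
    have "(\<lambda>x. (C (Suc n) x - C n x)\<^sup>2)
      = (\<lambda>x. C (Suc n) x * C (Suc n) x - 2 * (C n x * C (Suc n) x) + C n x * C n x)"
      by (auto simp: power2_eq_square algebra_simps)
    then show ?thesis using ii by simp
  qed
  have "0 \<le> e (Suc n) - e n" for n
    unfolding incr[symmetric] by simp
  then have "incseq e" by (intro incseq_SucI) simp
  moreover have "e n \<le> c\<^sup>2" for n
  proof -
    have "AE x in M. (C n x)\<^sup>2 \<le> c\<^sup>2"
      using Cb2[of n n] by eventually_elim (simp add: power2_eq_square)
    then show ?thesis
      unfolding e_def using integral_mono_AE[of M "\<lambda>x. (C n x)\<^sup>2" "\<lambda>_. c\<^sup>2"] ii[of n n]
      by (simp add: power2_eq_square prob_space)
  qed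
  ultimately obtain L where L: "e \<longlonglongrightarrow> L"
    using incseq_convergent[of e "c\<^sup>2"] by blast
  have "(\<lambda>n. e (Suc n) - e n) \<longlonglongrightarrow> L - L"
    using L by (intro tendsto_diff LIMSEQ_Suc)
  then have lim: "(\<lambda>n. sqrt (e (Suc n) - e n)) \<longlonglongrightarrow> 0"
    using tendsto_real_sqrt by fastforce
  have le: "(\<integral>x. \<bar>C (Suc n) x - C n x\<bar> \<partial>M) \<le> sqrt (e (Suc n) - e n)" for n
    using integral_abs_le_sqrt[OF _ iD[of n]] by (simp add: incr)
  have "(\<lambda>n. \<integral>x. \<bar>C (Suc n) x - C n x\<bar> \<partial>M) \<longlonglongrightarrow> 0"
  proof (rule tendsto_sandwich[OF _ _ tendsto_const lim])
    show "\<forall>\<^sub>F n in sequentially. (\<integral>x. \<bar>C (Suc n) x - C n x\<bar> \<partial>M) \<le> sqrt (e (Suc n) - e n)"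
      by (intro always_eventually allI le)
  qed simp
  then show ?thesis
    by (simp add: C_def)
qed

lemma (in prob_space) closed_martingale_increments:
  fixes f :: "'a \<Rightarrow> real"
  assumes sub: "\<And>n. subalgebra M (F n)"
    and mono: "\<And>n. sets (F n) \<subseteq> sets (F (Suc n))"
    and f: "integrable M f"
  shows "(\<lambda>n. \<integral>x. \<bar>real_cond_exp M (F (Suc n)) f x - real_cond_exp M (F n) f x\<bar> \<partial>M) \<longlonglongrightarrow> 0"
proof (rule LIMSEQ_I)
  have [measurable]: "f \<in> borel_measurable M" using f by auto
  fix r :: real assume r: "0 < r"
  define t where "t k x = max (- real k) (min (real k) (f x))" for k x
  have [measurable]: "t k \<in> borel_measurable M" for k unfolding t_def by simp
  have tb: "\<bar>t k x\<bar> \<le> real k" for k x unfolding t_def by auto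
  have ti: "integrable M (t k)" for k
    by (rule integrable_const_bound[of _ "real k"]) (auto simp: tb)
  have "(\<lambda>k. \<integral>x. \<bar>f x - t k x\<bar> \<partial>M) \<longlonglongrightarrow> (\<integral>x. 0 \<partial>M)"
  proof (rule integral_dominated_convergence[where w="\<lambda>x. \<bar>f x\<bar>"])
    show "AE x in M. (\<lambda>k. \<bar>f x - t k x\<bar>) \<longlonglongrightarrow> 0"
    proof (rule AE_I2)
      fix x
      obtain N :: nat where N: "\<bar>f x\<bar> \<le> real N" using real_arch_simple by blast
      have "\<forall>\<^sub>F k in sequentially. \<bar>f x - t k x\<bar> = 0"
        using eventually_ge_at_top[of N]
        by eventually_elim (use N in \<open>auto simp: t_def abs_le_iff\<close>)
      then show "(\<lambda>k. \<bar>f x - t k x\<bar>) \<longlonglongrightarrow> 0"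
        by (rule tendsto_eventually)
    qed
  qed (use f in \<open>auto simp: t_def intro!: AE_I2\<close>)
  \<comment> \<open>Three errors of size \<open>r / 3\<close> are budgeted: truncation at time
    \<open>n\<close>, truncation at time \<open>Suc n\<close>, and the increment of the truncated
    martingale. The first two are bounded for all \<open>n\<close> at once by the L1 contraction, so
    \<open>k\<close> can be fixed before \<open>N\<close>.\<close>
  then obtain k where k: "(\<integral>x. \<bar>f x - t k x\<bar> \<partial>M) < r / 3"
    using r by (auto dest!: LIMSEQ_D[where r="r/3"])
  have S: "finite_measure_subalgebra M (F n)" for n
    by (simp add: finite_measure_subalgebra_def finite_measure_subalgebra_axioms_def sub finite_measure_axioms)
  have i: "integrable M (real_cond_exp M (F n) f)" "integrable M (real_cond_exp M (F n) (t k))" for n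
  proof -
    interpret finite_measure_subalgebra M "F n" by (rule S)
    show "integrable M (real_cond_exp M (F n) f)" "integrable M (real_cond_exp M (F n) (t k))"
      using f ti by auto
  qed
  have close: "(\<integral>x. \<bar>real_cond_exp M (F n) f x - real_cond_exp M (F n) (t k) x\<bar> \<partial>M) \<le> r / 3" for n
  proof -
    interpret finite_measure_subalgebra M "F n" by (rule S)
    have "AE x in M. real_cond_exp M (F n) (\<lambda>x. f x - t k x) x = real_cond_exp M (F n) f x - real_cond_exp M (F n) (t k) x"
      using f ti by (rule real_cond_exp_diff)
    then have "(\<integral>x. \<bar>real_cond_exp M (F n) f x - real_cond_exp M (F n) (t k) x\<bar> \<partial>M)
      = (\<integral>x. \<bar>real_cond_exp M (F n) (\<lambda>x. f x - t k x) x\<bar> \<partial>M)"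
      by (intro integral_cong_AE) auto
    also have "\<dots> \<le> (\<integral>x. \<bar>f x - t k x\<bar> \<partial>M)"
      using f ti by (intro real_cond_exp_L1_contraction) auto
    finally show ?thesis using k by simp
  qed
  have "(\<lambda>n. \<integral>x. \<bar>real_cond_exp M (F (Suc n)) (t k) x - real_cond_exp M (F n) (t k) x\<bar> \<partial>M) \<longlonglongrightarrow> 0"
    by (rule bounded_martingale_increments[where c="real k"]) (use sub mono tb in auto)
  then have "\<exists>N. \<forall>n\<ge>N. norm ((\<integral>x. \<bar>real_cond_exp M (F (Suc n)) (t k) x - real_cond_exp M (F n) (t k) x\<bar> \<partial>M) - 0) < r / 3"
    using r by (intro LIMSEQ_D) auto
  then obtain N where N: "(\<integral>x. \<bar>real_cond_exp M (F (Suc n)) (t k) x - real_cond_exp M (F n) (t k) x\<bar> \<partial>M) < r / 3"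
    if "n \<ge> N" for n by (auto simp only: real_norm_def diff_0_right abs_less_iff)
  show "\<exists>N. \<forall>n\<ge>N. norm ((\<integral>x. \<bar>real_cond_exp M (F (Suc n)) f x - real_cond_exp M (F n) f x\<bar> \<partial>M) - 0) < r"
  proof (intro exI allI impI)
    fix n assume n: "N \<le> n"
    have "(\<integral>x. \<bar>real_cond_exp M (F (Suc n)) f x - real_cond_exp M (F n) f x\<bar> \<partial>M)
      \<le> (\<integral>x. \<bar>real_cond_exp M (F (Suc n)) f x - real_cond_exp M (F (Suc n)) (t k) x\<bar>
           + \<bar>real_cond_exp M (F (Suc n)) (t k) x - real_cond_exp M (F n) (t k) x\<bar>
           + \<bar>real_cond_exp M (F n) f x - real_cond_exp M (F n) (t k) x\<bar> \<partial>M)"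
      using i by (intro integral_mono) auto
    also have "\<dots> = (\<integral>x. \<bar>real_cond_exp M (F (Suc n)) f x - real_cond_exp M (F (Suc n)) (t k) x\<bar> \<partial>M)
           + (\<integral>x. \<bar>real_cond_exp M (F (Suc n)) (t k) x - real_cond_exp M (F n) (t k) x\<bar> \<partial>M)
           + (\<integral>x. \<bar>real_cond_exp M (F n) f x - real_cond_exp M (F n) (t k) x\<bar> \<partial>M)"
      using i by (simp add: integral_add)
    also have "\<dots> < r" using close[of n] close[of "Suc n"] N[OF n] by linarith
    finally show "norm ((\<integral>x. \<bar>real_cond_exp M (F (Suc n)) f x - real_cond_exp M (F n) f x\<bar> \<partial>M) - 0) < r"
      by simp
  qed
qed

subsection \<open>Total variation distance\<close>

text \<open>The supremum is attained at the sign of \<open>p - r\<close>. With test functions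
  bounded by 1 in absolute value, no factor 1/2 appears.\<close>

lemma tv_dist_density:
  fixes p r :: "'a \<Rightarrow> real"
  assumes i[simp]: "integrable D p" "integrable D r" and nn: "\<And>x. 0 \<le> p x" "\<And>x. 0 \<le> r x"
  shows "tv_dist (density D p) (density D r) = (\<integral>x. \<bar>p x - r x\<bar> \<partial>D)"
proof -
  have [measurable]: "p \<in> borel_measurable D" "r \<in> borel_measurable D" by (intro borel_measurable_integrable i)+
  let ?S = "{f. f \<in> borel_measurable (density D p) \<and> (\<forall>x. \<bar>f x :: real\<bar> \<le> 1)}"
  have eq: "(\<integral>x. f x \<partial>density D p) - (\<integral>x. f x \<partial>density D r) = (\<integral>x. (p x - r x) * f x \<partial>D)"
    if "f \<in> ?S" for f
  proof -
    have [measurable]: "f \<in> borel_measurable D" and b: "\<And>x. \<bar>f x\<bar> \<le> 1" using that by auto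
    have "integrable D (\<lambda>x. p x * f x)" "integrable D (\<lambda>x. r x * f x)"
      by (rule Bochner_Integration.integrable_bound[OF i(1)], use b in \<open>auto simp: abs_mult mult_left_le\<close>)
         (rule Bochner_Integration.integrable_bound[OF i(2)], use b in \<open>auto simp: abs_mult mult_left_le\<close>)
    then show ?thesis
      by (subst (1 2) integral_density) (auto simp: nn left_diff_distrib)
  qed
  have le: "\<bar>(\<integral>x. f x \<partial>density D p) - (\<integral>x. f x \<partial>density D r)\<bar> \<le> (\<integral>x. \<bar>p x - r x\<bar> \<partial>D)"
    if f: "f \<in> ?S" for f
    unfolding eq[OF f]
    by (intro order_trans[OF integral_abs_bound] integral_mono')
       (use f in \<open>auto simp: abs_mult mult_left_le\<close>)
  have sgn: "(\<lambda>x. sgn (p x - r x)) \<in> ?S" by (auto simp: sgn_if)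
  show ?thesis
    unfolding tv_dist_def
  proof (rule cSup_eq_maximum)
    have "(\<integral>x. \<bar>p x - r x\<bar> \<partial>D) = \<bar>(\<integral>x. sgn (p x - r x) \<partial>density D p) - (\<integral>x. sgn (p x - r x) \<partial>density D r)\<bar>"
      by (subst eq[OF sgn]) (simp add: abs_sgn[symmetric])
    then show "(\<integral>x. \<bar>p x - r x\<bar> \<partial>D) \<in> (\<lambda>f. \<bar>(\<integral>x. f x \<partial>density D p) - (\<integral>x. f x \<partial>density D r)\<bar>) ` ?S"
      by (rule image_eqI[OF _ sgn])
  qed (use le in auto)
qed

text \<open>\<open>D\<close> is the average of \<open>P\<close> and \<open>R\<close>, whose null
  sets are null for both. It is built as the mixture of the two along a fair coin.\<close>

lemma exists_dominating_density:
  fixes P R :: "'a measure"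
  assumes "prob_space P" "prob_space R" "sets R = sets P"
  obtains D and p r :: "'a \<Rightarrow> real" where "sets D = sets P" "integrable D p" "integrable D r"
    "\<And>x. 0 \<le> p x" "\<And>x. 0 \<le> r x" "P = density D p" "R = density D r"
proof -
  interpret P: prob_space P by fact
  interpret R: prob_space R by fact
  define k where "k b = (if b then P else R)" for b
  have [simp]: "subprob_space (k b)" "sets (k b) = sets P" for b
    using assms by (auto simp: k_def prob_space_imp_subprob_space)
  have k: "k \<in> measure_pmf (bernoulli_pmf (1/2)) \<rightarrow>\<^sub>M subprob_algebra P"
    by (auto simp: space_subprob_algebra)
  define D where "D = measure_pmf (bernoulli_pmf (1/2)) \<bind> k"
  have sD: "sets D = sets P" unfolding D_def by (rule sets_bind) auto
  have eD: "emeasure D A = ennreal (1/2) * emeasure P A + ennreal (1/2) * emeasure R A" if "A \<in> sets P" for A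
    unfolding D_def by (subst emeasure_bind[OF _ k that]) (auto simp: k_def mult.commute)
  interpret D: subprob_space D
    unfolding D_def by (rule subprob_space_bind[OF _ k]) (simp add: prob_space_imp_subprob_space measure_pmf.prob_space_axioms)
  have acP: "absolutely_continuous D P" and acR: "absolutely_continuous D R"
    unfolding absolutely_continuous_def null_sets_def using eD by (auto simp: sD assms)
  obtain p :: "'a \<Rightarrow> real" where p: "p \<in> borel_measurable D" "\<And>x. 0 \<le> p x" "P = density D p"
    using exists_real_density[OF D.sigma_finite_measure_axioms P.finite_measure_axioms acP] sD by auto
  obtain r :: "'a \<Rightarrow> real" where r: "r \<in> borel_measurable D" "\<And>x. 0 \<le> r x" "R = density D r"
    using exists_real_density[OF D.sigma_finite_measure_axioms R.finite_measure_axioms acR] sD assms by auto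
  have "(\<integral>\<^sup>+x. p x \<partial>D) = emeasure (density D p) (space D)" "(\<integral>\<^sup>+x. r x \<partial>D) = emeasure (density D r) (space D)"
    using p(1) r(1) by (auto simp: emeasure_density intro!: nn_integral_cong)
  moreover have "emeasure (density D p) (space D) = 1" "emeasure (density D r) (space D) = 1"
    using P.emeasure_space_1 R.emeasure_space_1 p(3) r(3) by (metis space_density)+
  ultimately have "(\<integral>\<^sup>+x. p x \<partial>D) = 1" "(\<integral>\<^sup>+x. r x \<partial>D) = 1" by simp_all
  then have "integrable D p" "integrable D r"
    using p r by (auto intro!: integrableI_nonneg)
  with that p r sD show thesis by blast
qed

text \<open>The function \<open>2 * indicator A x - 1\<close> takes only the values 1 and -1, so its
  integral against \<open>p - r\<close> is at most that of \<open>\<bar>p x - r x\<bar>\<close>,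
  with equality for the Hahn set where \<open>r < p\<close>. As both measures have mass 1, that
  integral is \<open>2 * (measure P A - measure R A)\<close>. Test functions are thereby traded for
  sets, to which regularity applies.\<close>

lemma tv_dist_eq_twice_Sup:
  fixes P R :: "'a measure"
  assumes "prob_space P" "prob_space R" "sets R = sets P"
  obtains H where "H \<in> sets P" "tv_dist P R = 2 * (measure P H - measure R H)"
    "\<And>A. A \<in> sets P \<Longrightarrow> 2 * (measure P A - measure R A) \<le> tv_dist P R"
proof -
  interpret P: prob_space P by fact
  interpret R: prob_space R by fact
  obtain D and p r :: "'a \<Rightarrow> real" where D: "sets D = sets P" and i[simp]: "integrable D p" "integrable D r"
    and nn[simp]: "\<And>x. 0 \<le> p x" "\<And>x. 0 \<le> r x" and pr: "P = density D p" "R = density D r"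
    using exists_dominating_density[OF assms] by blast
  have [measurable]: "p \<in> borel_measurable D" "r \<in> borel_measurable D" by (intro borel_measurable_integrable i)+
  have m: "measure P A = (\<integral>x. p x * indicator A x \<partial>D)" "measure R A = (\<integral>x. r x * indicator A x \<partial>D)"
    and ii: "integrable D (\<lambda>x. p x * indicator A x)" "integrable D (\<lambda>x. r x * indicator A x)"
    if [measurable]: "A \<in> sets P" for A
  proof -
    have [measurable]: "A \<in> sets D" by (simp add: D)
    show "integrable D (\<lambda>x. p x * indicator A x)" "integrable D (\<lambda>x. r x * indicator A x)"
      by (intro integrable_real_mult_indicator; simp)+
    have "space P = space D" "space R = space D" unfolding pr by simp_all
    then have "measure P A = integral\<^sup>L P (indicator A)" "measure R A = integral\<^sup>L R (indicator A)"
      using sets.sets_into_space[OF that] by (auto simp: Int_absorb2)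
    moreover have "integral\<^sup>L (density D p) (indicat_real A) = (\<integral>x. p x *\<^sub>R indicat_real A x \<partial>D)"
      by (rule integral_density) simp_all
    moreover have "integral\<^sup>L (density D r) (indicat_real A) = (\<integral>x. r x *\<^sub>R indicat_real A x \<partial>D)"
      by (rule integral_density) simp_all
    ultimately show "measure P A = (\<integral>x. p x * indicator A x \<partial>D)" "measure R A = (\<integral>x. r x * indicator A x \<partial>D)"
      by (simp_all only: pr[symmetric] real_scaleR_def)
  qed
  have tv: "tv_dist P R = (\<integral>x. \<bar>p x - r x\<bar> \<partial>D)"
    unfolding pr by (rule tv_dist_density) auto
  have tot: "(\<integral>x. p x \<partial>D) = 1" "(\<integral>x. r x \<partial>D) = 1"
  proof -
    have "space R = space P" "space D = space P" using assms D by (auto dest: sets_eq_imp_space_eq)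
    then have "(\<integral>x. p x \<partial>D) = (\<integral>x. p x * indicator (space P) x \<partial>D)" "(\<integral>x. r x \<partial>D) = (\<integral>x. r x * indicator (space P) x \<partial>D)"
      by (auto intro!: Bochner_Integration.integral_cong)
    then show "(\<integral>x. p x \<partial>D) = 1" "(\<integral>x. r x \<partial>D) = 1"
      using m[of "space P"] P.prob_space R.prob_space \<open>space R = space P\<close> by simp_all
  qed
  have two: "2 * (measure P A - measure R A) = (\<integral>x. (p x - r x) * (2 * indicator A x - 1) \<partial>D)" if A: "A \<in> sets P" for A
  proof -
    have "(\<integral>x. (p x - r x) * (2 * indicator A x - 1) \<partial>D)
      = (\<integral>x. 2 * (p x * indicator A x) - 2 * (r x * indicator A x) - p x + r x \<partial>D)"
      by (intro Bochner_Integration.integral_cong) (auto simp: algebra_simps)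
    also have "\<dots> = 2 * measure P A - 2 * measure R A - 1 + 1"
      using ii[OF A] by (simp add: m[OF A] tot)
    finally show ?thesis by simp
  qed
  show thesis
  proof (rule that)
    show H: "{x\<in>space D. r x < p x} \<in> sets P" by (simp add: D[symmetric])
    show "tv_dist P R = 2 * (measure P {x\<in>space D. r x < p x} - measure R {x\<in>space D. r x < p x})"
      unfolding two[OF H] tv by (intro Bochner_Integration.integral_cong) (auto simp: indicator_def)
    fix A assume A: "A \<in> sets P"
    then have [measurable]: "A \<in> sets D" by (simp add: D)
    show "2 * (measure P A - measure R A) \<le> tv_dist P R"
      unfolding two[OF A] tv
    proof (rule integral_mono)
      show "integrable D (\<lambda>x. \<bar>p x - r x\<bar>)" by simp
      then show "integrable D (\<lambda>x. (p x - r x) * (2 * indicator A x - 1))"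
        by (rule Bochner_Integration.integrable_bound) (auto simp: indicator_def)
    qed (auto simp: indicator_def)
  qed
qed

text \<open>A supremum over countably many sets, which makes the distance of two kernels measurable.\<close>

lemma tv_dist_basis:
  fixes P R :: "'a::polish_space measure"
  assumes P: "prob_space P" "sets P = sets borel" and R: "prob_space R" "sets R = sets borel"
    and B: "countable B" "topological_basis B"
  shows "tv_dist P R = (SUP U\<in>Union ` {F. finite F \<and> F \<subseteq> B}. 2 * (measure P U - measure R U))"
proof -
  interpret P: prob_space P by fact
  interpret R: prob_space R by fact
  have op: "open U" if "U \<in> Union ` {F. finite F \<and> F \<subseteq> B}" for U
    using that topological_basis_open[OF B(2)] by (auto intro!: open_Union)
  obtain H where H: "H \<in> sets P" "tv_dist P R = 2 * (measure P H - measure R H)"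
    and le: "\<And>A. A \<in> sets P \<Longrightarrow> 2 * (measure P A - measure R A) \<le> tv_dist P R"
    using tv_dist_eq_twice_Sup[OF P(1) R(1)] P(2) R(2) by metis
  show ?thesis
  proof (rule antisym)
    show "(SUP U\<in>Union ` {F. finite F \<and> F \<subseteq> B}. 2 * (measure P U - measure R U)) \<le> tv_dist P R"
      by (intro cSUP_least le) (use op in \<open>auto simp: P(2)\<close>)
    show "tv_dist P R \<le> (SUP U\<in>Union ` {F. finite F \<and> F \<subseteq> B}. 2 * (measure P U - measure R U))"
    proof (rule field_le_epsilon)
      \<comment> \<open>Two approximations cost \<open>e/4\<close> each, and the factor 2 in front
        of the measures makes the total \<open>e\<close>. Outer regularity of \<open>R\<close>
        replaces \<open>H\<close> by an open \<open>V\<close>, which can only increase the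
        \<open>P\<close>-measure; then finitely many basic sets exhaust \<open>V\<close> up to
        \<open>e/4\<close> under \<open>P\<close>, which can only decrease the
        \<open>R\<close>-measure.\<close>
      fix e :: real assume e: "0 < e"
      have Hb: "H \<in> sets borel" using H P by simp
      have "emeasure R H < emeasure R H + ennreal (e/4)"
        using e by (simp add: R.emeasure_eq_measure ennreal_plus[symmetric] ennreal_less_iff del: ennreal_plus)
      then have "(INF U \<in> {U. H \<subseteq> U \<and> open U}. emeasure R U) < emeasure R H + ennreal (e/4)"
        by (subst outer_regular[OF R(2) _ Hb, symmetric]) simp_all
      then obtain V where V: "H \<subseteq> V" "open V" "emeasure R V < emeasure R H + ennreal (e/4)"
        by (auto simp: INF_less_iff)
      have RV: "measure R V \<le> measure R H + e/4"
        using V(3) e by (simp add: R.emeasure_eq_measure ennreal_plus[symmetric] ennreal_less_iff del: ennreal_plus)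
      have PV: "measure P H \<le> measure P V"
        using V P by (intro P.finite_measure_mono) auto
      obtain F where F: "F \<subseteq> B" "\<Union>F = V" using B(2) V(2) unfolding topological_basis_def by metis
      have "\<exists>G. finite G \<and> G \<subseteq> B \<and> \<Union>G \<subseteq> V \<and> measure P V \<le> measure P (\<Union>G) + e/4"
      proof (cases "F = {}")
        case True then show ?thesis using F e by (intro exI[of _ "{}"]) auto
      next
        case False
        have cF: "countable F" using F B countable_subset by blast
        \<comment> \<open>The first \<open>n\<close> members in an enumeration of \<open>F\<close>:
          their unions increase to \<open>V\<close>, so continuity from below applies. The
          enumeration lists exactly \<open>F\<close> because \<open>F\<close> is non-empty
          here.\<close>
        define G where "G n = from_nat_into F ` {..<n}" for n :: nat
        have GF: "G n \<subseteq> F" for n using from_nat_into[OF False] by (auto simp: G_def)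
        have "(\<Union>n. \<Union>(G n)) = V"
        proof -
          have "(\<Union>n. G n) = from_nat_into F ` (\<Union>n. {..<n})"
            unfolding G_def by (simp only: image_UN)
          also have "\<dots> = F"
            by (simp only: UN_lessThan_UNIV range_from_nat_into[OF False cF])
          finally have "\<Union>(\<Union>n. G n) = V" using F(2) by simp
          then show ?thesis by blast
        qed
        moreover have "(\<lambda>n. measure P (\<Union>(G n))) \<longlonglongrightarrow> measure P (\<Union>n. \<Union>(G n))"
        proof (rule P.finite_Lim_measure_incseq)
          show "range (\<lambda>n. \<Union>(G n)) \<subseteq> sets P"
          proof
            fix A assume "A \<in> range (\<lambda>n. \<Union>(G n))"
            then obtain n where A: "A = \<Union>(G n)" by blast
            have "open A" unfolding A using GF[of n] F(1) topological_basis_open[OF B(2)] by (intro open_Union) blast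
            then show "A \<in> sets P" by (simp add: P(2))
          qed
          show "incseq (\<lambda>n. \<Union>(G n))"
            unfolding incseq_def G_def by (intro allI impI Union_mono image_mono) auto
        qed
        ultimately have "\<exists>N. \<forall>n\<ge>N. norm (measure P (\<Union>(G n)) - measure P V) < e/4"
          using e by (intro LIMSEQ_D) simp_all
        then obtain N where "norm (measure P (\<Union>(G N)) - measure P V) < e/4" by blast
        then have "measure P V \<le> measure P (\<Union>(G N)) + e/4"
          unfolding real_norm_def by linarith
        moreover have "\<Union>(G N) \<subseteq> V" "G N \<subseteq> B" using GF[of N] F by blast+
        ultimately show ?thesis
          by (intro exI[of _ "G N"]) (simp add: G_def)
      qed
      then obtain G where G: "finite G" "G \<subseteq> B" "\<Union>G \<subseteq> V" "measure P V \<le> measure P (\<Union>G) + e/4" by blast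
      have RG: "measure R (\<Union>G) \<le> measure R V"
        using V G R by (intro R.finite_measure_mono) auto
      have "2 * (measure P (\<Union>G) - measure R (\<Union>G)) \<le> (SUP U\<in>Union ` {F. finite F \<and> F \<subseteq> B}. 2 * (measure P U - measure R U))"
        by (intro cSUP_upper bdd_aboveI2[of _ _ "tv_dist P R"] le) (use G op in \<open>auto simp: P(2)\<close>)
      then show "tv_dist P R \<le> (SUP U\<in>Union ` {F. finite F \<and> F \<subseteq> B}. 2 * (measure P U - measure R U)) + e"
        using RG G(4) PV RV H(2) by argo
    qed
  qed
qed

lemma prob_algebra_kernelD:
  assumes "K \<in> S \<rightarrow>\<^sub>M prob_algebra N" "u \<in> space S"
  shows "prob_space (K u)" "sets (K u) = sets N"
  using measurable_space[OF assms] by (auto simp: space_prob_algebra)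

text \<open>The finite unions of basic open sets form one countable family that serves every
  \<open>u\<close>, so the distance is a countable supremum of measurable functions.\<close>

lemma measurable_tv_dist:
  fixes K L :: "'s \<Rightarrow> 'a::polish_space measure"
  assumes K[measurable]: "K \<in> S \<rightarrow>\<^sub>M prob_algebra borel" and L[measurable]: "L \<in> S \<rightarrow>\<^sub>M prob_algebra borel"
  shows "(\<lambda>u. tv_dist (K u) (L u)) \<in> borel_measurable S"
proof -
  obtain B :: "'a set set" where B: "countable B" "topological_basis B"
    using ex_countable_basis by blast
  let ?C = "Union ` {F. finite F \<and> F \<subseteq> B}"
  have C: "countable ?C"
    using countable_Collect_finite_subset[OF B(1)] by (rule countable_image)
  have "(\<lambda>u. SUP U\<in>?C. 2 * (measure (K u) U - measure (L u) U)) \<in> borel_measurable S"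
  proof (rule borel_measurable_cSUP[OF C])
    fix U assume "U \<in> ?C"
    then have [measurable]: "U \<in> sets borel"
      using topological_basis_open[OF B(2)] by (auto intro!: borel_open open_Union)
    show "(\<lambda>u. 2 * (measure (K u) U - measure (L u) U)) \<in> borel_measurable S"
      by measurable
  next
    fix u assume u: "u \<in> space S"
    interpret K: prob_space "K u" using prob_algebra_kernelD[OF K u] by simp
    show "bdd_above ((\<lambda>U. 2 * (measure (K u) U - measure (L u) U)) ` ?C)"
    proof (rule bdd_aboveI2)
      show "2 * (measure (K u) U - measure (L u) U) \<le> 2" for U
        using K.prob_le_1[of U] measure_nonneg[of "L u" U] by argo
    qed
  qed
  moreover have eq: "tv_dist (K u) (L u) = (SUP U\<in>Union ` {F. finite F \<and> F \<subseteq> B}. 2 * (measure (K u) U - measure (L u) U))"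
    if "u \<in> space S" for u
    using tv_dist_basis[OF prob_algebra_kernelD[OF K that] prob_algebra_kernelD[OF L that] B] .
  ultimately show ?thesis by (intro measurable_cong[THEN iffD2, OF eq])
qed

subsection \<open>Disintegration along a kernel\<close>

lemma measure_eqI_pair:
  assumes "finite_measure M" and M: "sets M = sets (A \<Otimes>\<^sub>M B)" and N: "sets N = sets (A \<Otimes>\<^sub>M B)"
    and eq: "\<And>a b. a \<in> sets A \<Longrightarrow> b \<in> sets B \<Longrightarrow> emeasure M (a \<times> b) = emeasure N (a \<times> b)"
  shows "M = N"
proof -
  interpret finite_measure M by fact
  let ?E = "{a \<times> b | a b. a \<in> sets A \<and> b \<in> sets B}"
  show ?thesis
  proof (rule measure_eqI_generator_eq[OF Int_stable_pair_measure_generator[of A B], where A="\<lambda>_. space A \<times> space B"])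
    show "?E \<subseteq> Pow (space A \<times> space B)"
      using sets.space_closed[of A] sets.space_closed[of B] by auto
    show "sets M = sigma_sets (space A \<times> space B) ?E" "sets N = sigma_sets (space A \<times> space B) ?E"
      by (simp_all add: M N sets_pair_measure)
    show "emeasure M (space A \<times> space B) \<noteq> \<infinity>" by simp
  qed (use eq in auto)
qed

text \<open>Regular conditional distribution of \<open>X\<close> given an arbitrary variable
  \<open>U\<close>. One notion covers filters and predictors, the Markov transition given the past
  path, and, with a constant kernel, independence of \<open>X\<close> from \<open>U\<close>.\<close>

definition cond_kernel :: "'w measure \<Rightarrow> 'a measure \<Rightarrow> ('w \<Rightarrow> 'a) \<Rightarrow> 's measure \<Rightarrow> ('w \<Rightarrow> 's) \<Rightarrow> ('s \<Rightarrow> 'a measure) \<Rightarrow> bool" where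
  "cond_kernel P A X S U K \<longleftrightarrow> X \<in> P \<rightarrow>\<^sub>M A \<and> U \<in> P \<rightarrow>\<^sub>M S \<and> K \<in> S \<rightarrow>\<^sub>M prob_algebra A \<and>
    (\<forall>a\<in>sets A. \<forall>b\<in>sets S. emeasure P {\<omega> \<in> space P. X \<omega> \<in> a \<and> U \<omega> \<in> b}
      = (\<integral>\<^sup>+\<omega>. indicator b (U \<omega>) * emeasure (K (U \<omega>)) a \<partial>P))"

lemma kernel_pair_measurable:
  assumes K[measurable]: "K \<in> S \<rightarrow>\<^sub>M prob_algebra A"
  shows "(\<lambda>u. distr (K u) (A \<Otimes>\<^sub>M S) (\<lambda>x. (x, u))) \<in> S \<rightarrow>\<^sub>M prob_algebra (A \<Otimes>\<^sub>M S)"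
  by measurable

lemma nn_integral_kernel_measurable:
  assumes K: "K \<in> S \<rightarrow>\<^sub>M prob_algebra A" and [measurable]: "f \<in> borel_measurable (A \<Otimes>\<^sub>M S)"
  shows "(\<lambda>u. \<integral>\<^sup>+x. f (x, u) \<partial>K u) \<in> borel_measurable S"
  by (rule nn_integral_measurable_subprob_algebra2[OF _ measurable_prob_algebraD[OF K]]) measurable

text \<open>The defining equation says on rectangles that the law of \<open>(X, U)\<close> is the
  law of \<open>U\<close> followed by the kernel that draws \<open>x\<close> from \<open>K u\<close>
  and keeps \<open>u\<close>. Rectangles determine a finite measure on the product, and the integral
  of a composition is an iterated integral.\<close>

lemma nn_integral_disintegration:
  assumes P: "prob_space P" and ck: "cond_kernel P A X S U K"
    and f[measurable]: "f \<in> borel_measurable (A \<Otimes>\<^sub>M S)"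
  shows "(\<integral>\<^sup>+\<omega>. f (X \<omega>, U \<omega>) \<partial>P) = (\<integral>\<^sup>+\<omega>. \<integral>\<^sup>+x. f (x, U \<omega>) \<partial>K (U \<omega>) \<partial>P)"
proof -
  interpret P: prob_space P by fact
  have X[measurable]: "X \<in> P \<rightarrow>\<^sub>M A" and U[measurable]: "U \<in> P \<rightarrow>\<^sub>M S" and K: "K \<in> S \<rightarrow>\<^sub>M prob_algebra A"
    and eq: "\<And>a b. a \<in> sets A \<Longrightarrow> b \<in> sets S \<Longrightarrow>
      emeasure P {\<omega> \<in> space P. X \<omega> \<in> a \<and> U \<omega> \<in> b} = (\<integral>\<^sup>+\<omega>. indicator b (U \<omega>) * emeasure (K (U \<omega>)) a \<partial>P)"
    using ck unfolding cond_kernel_def by auto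
  define N where "N = distr P S U"
  interpret N: prob_space N unfolding N_def by (rule P.prob_space_distr) simp
  have sN[measurable_cong, simp]: "sets N = sets S" by (simp add: N_def)
  have spN: "space N = space S" by (simp add: N_def)
  let ?k = "\<lambda>u. distr (K u) (A \<Otimes>\<^sub>M S) (\<lambda>x. (x, u))"
  have k: "?k \<in> N \<rightarrow>\<^sub>M subprob_algebra (A \<Otimes>\<^sub>M S)"
    using measurable_prob_algebraD[OF kernel_pair_measurable[OF K]] by (simp cong: measurable_cong_sets)
  have Ks: "sets (K u) = sets A" "space (K u) = space A" "prob_space (K u)" if "u \<in> space S" for u
    using prob_algebra_kernelD[OF K that] by (auto dest: sets_eq_imp_space_eq)
  have pm: "(\<lambda>x. (x, u)) \<in> K u \<rightarrow>\<^sub>M A \<Otimes>\<^sub>M S" if "u \<in> space S" for u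
    using that Ks(1)[OF that] by (simp cong: measurable_cong_sets)
  have "distr P (A \<Otimes>\<^sub>M S) (\<lambda>\<omega>. (X \<omega>, U \<omega>)) = N \<bind> ?k"
  proof (rule measure_eqI_pair[of _ A S])
    show "finite_measure (distr P (A \<Otimes>\<^sub>M S) (\<lambda>\<omega>. (X \<omega>, U \<omega>)))"
      by (intro P.finite_measure_distr) simp
    show "sets (N \<bind> ?k) = sets (A \<Otimes>\<^sub>M S)"
      using N.not_empty by (intro sets_bind) auto
    fix a b assume ab[measurable]: "a \<in> sets A" "b \<in> sets S"
    have "emeasure (distr P (A \<Otimes>\<^sub>M S) (\<lambda>\<omega>. (X \<omega>, U \<omega>))) (a \<times> b) = emeasure P {\<omega> \<in> space P. X \<omega> \<in> a \<and> U \<omega> \<in> b}"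
      by (subst emeasure_distr) (auto intro!: arg_cong[where f="emeasure P"])
    also have "\<dots> = (\<integral>\<^sup>+\<omega>. indicator b (U \<omega>) * emeasure (K (U \<omega>)) a \<partial>P)"
      by (rule eq) (rule ab)+
    also have "\<dots> = (\<integral>\<^sup>+u. indicator b u * emeasure (K u) a \<partial>N)"
      unfolding N_def using measurable_prob_algebraD[OF K]
      by (subst nn_integral_distr) (auto intro!: borel_measurable_times_ennreal measurable_emeasure_kernel)
    also have "\<dots> = (\<integral>\<^sup>+u. emeasure (?k u) (a \<times> b) \<partial>N)"
    proof (rule nn_integral_cong)
      fix u assume "u \<in> space N"
      then have u: "u \<in> space S" by (simp add: spN)
      show "indicator b u * emeasure (K u) a = emeasure (?k u) (a \<times> b)"
        using pm[OF u] Ks[OF u] sets.sets_into_space[OF ab(1)]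
        by (subst emeasure_distr) (auto simp: indicator_def Int_absorb2 intro!: arg_cong[where f="emeasure (K u)"])
    qed
    also have "\<dots> = emeasure (N \<bind> ?k) (a \<times> b)"
      by (rule emeasure_bind[OF _ k, symmetric]) (use N.not_empty in auto)
    finally show "emeasure (distr P (A \<Otimes>\<^sub>M S) (\<lambda>\<omega>. (X \<omega>, U \<omega>))) (a \<times> b) = emeasure (N \<bind> ?k) (a \<times> b)" .
  qed simp
  moreover have "(\<integral>\<^sup>+\<omega>. f (X \<omega>, U \<omega>) \<partial>P) = (\<integral>\<^sup>+z. f z \<partial>distr P (A \<Otimes>\<^sub>M S) (\<lambda>\<omega>. (X \<omega>, U \<omega>)))"
    by (subst nn_integral_distr) auto
  ultimately have "(\<integral>\<^sup>+\<omega>. f (X \<omega>, U \<omega>) \<partial>P) = (\<integral>\<^sup>+z. f z \<partial>(N \<bind> ?k))"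
    by simp
  also have "\<dots> = (\<integral>\<^sup>+u. \<integral>\<^sup>+z. f z \<partial>?k u \<partial>N)"
    by (rule nn_integral_bind[OF f k])
  also have "\<dots> = (\<integral>\<^sup>+u. \<integral>\<^sup>+x. f (x, u) \<partial>K u \<partial>N)"
    using pm by (intro nn_integral_cong) (simp add: nn_integral_distr spN)
  also have "\<dots> = (\<integral>\<^sup>+\<omega>. \<integral>\<^sup>+x. f (x, U \<omega>) \<partial>K (U \<omega>) \<partial>P)"
    unfolding N_def by (rule nn_integral_distr[OF U]) (simp add: nn_integral_kernel_measurable[OF K f])
  finally show ?thesis .
qed

text \<open>Finite intersections of members of a countable base are still countably many, and they
  are closed under intersection; the empty intersection contributes \<open>UNIV\<close>.
  Countability is what later merges the exceptional null sets of single sets into one.\<close>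

lemma exists_countable_generator:
  obtains G :: "'a::second_countable_topology set set"
  where "countable G" "Int_stable G" "UNIV \<in> G" "sets borel = sigma_sets UNIV G"
proof -
  obtain B :: "'a set set" where B: "countable B" "topological_basis B"
    using ex_countable_basis by blast
  define G where "G = Inter ` {F. finite F \<and> F \<subseteq> B}"
  have "countable G"
    unfolding G_def using countable_Collect_finite_subset[OF B(1)] by (rule countable_image)
  moreover have "Int_stable G"
  proof (rule Int_stableI)
    fix a b assume "a \<in> G" "b \<in> G"
    then obtain F F' where "a = \<Inter>F" "finite F" "F \<subseteq> B" "b = \<Inter>F'" "finite F'" "F' \<subseteq> B" unfolding G_def by blast
    then have "a \<inter> b = \<Inter>(F \<union> F')" "F \<union> F' \<in> {F. finite F \<and> F \<subseteq> B}" by auto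
    then show "a \<inter> b \<in> G" unfolding G_def by (rule image_eqI)
  qed
  moreover have "UNIV \<in> G" unfolding G_def by (rule image_eqI[of _ _ "{}"]) auto
  moreover have "sets borel = sigma_sets UNIV G"
  proof (rule antisym)
    have "B \<subseteq> G"
    proof
      fix b assume "b \<in> B" then show "b \<in> G" unfolding G_def by (intro image_eqI[of _ _ "{b}"]) auto
    qed
    then show "sets borel \<subseteq> sigma_sets UNIV G"
      unfolding borel_eq_countable_basis[OF B] by (simp add: sigma_sets_mono')
    have "open g" if "g \<in> G" for g
      using that topological_basis_open[OF B(2)] unfolding G_def by (auto intro!: open_Inter)
    then have "G \<subseteq> sets borel" by auto
    then show "sigma_sets UNIV G \<subseteq> sets borel"
      using sets.sigma_sets_subset[of G borel] by simp
  qed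
  ultimately show thesis by (rule that)
qed

subsection \<open>Total variation between conditional laws\<close>

lemma tv_dist_nonneg:
  assumes "prob_space P" "prob_space R" "sets R = sets P"
  shows "0 \<le> tv_dist P R"
  using tv_dist_eq_twice_Sup[OF assms] by (metis diff_self measure_empty mult_zero_right sets.empty_sets)

text \<open>For \<open>m > 0\<close> the measure \<open>L\<close> has density \<open>g x / m\<close>
  relative to \<open>K\<close>, and the claim is the L1 formula multiplied by \<open>m\<close>. The
  scaled form also covers \<open>m = 0\<close>: there \<open>eq\<close> says nothing about
  \<open>L\<close>, but \<open>g\<close> vanishes almost everywhere and both sides are 0.\<close>

lemma tv_dist_of_scaled_density:
  fixes K L :: "'a::polish_space measure" and g :: "'a \<Rightarrow> real"
  assumes K: "prob_space K" "sets K = sets borel" and L: "prob_space L" "sets L = sets borel"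
    and G: "Int_stable G" "UNIV \<in> G" "sets borel = sigma_sets UNIV G"
    and [measurable]: "g \<in> borel_measurable borel" and g0: "\<And>x. 0 \<le> g x" and m0: "0 \<le> m"
    and eq: "\<And>a. a \<in> G \<Longrightarrow> ennreal m * emeasure L a = (\<integral>\<^sup>+x. ennreal (g x) * indicator a x \<partial>K)"
  shows "ennreal (m * tv_dist L K) = (\<integral>\<^sup>+x. ennreal \<bar>g x - m\<bar> \<partial>K)"
proof -
  interpret K: prob_space K by fact
  interpret L: prob_space L by fact
  have [measurable_cong, simp]: "sets K = sets borel" by fact
  have spL[simp]: "space L = UNIV" "space K = UNIV" using sets_eq_imp_space_eq[OF L(2)] sets_eq_imp_space_eq[OF K(2)] by auto
  have gm: "(\<integral>\<^sup>+x. ennreal (g x) \<partial>K) = ennreal m"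
    using eq[OF G(2)] L.emeasure_space_1 by simp
  show ?thesis
  proof (cases "m = 0")
    case True
    then have "AE x in K. ennreal (g x) = 0"
      using gm by (subst nn_integral_0_iff_AE[symmetric]) auto
    then have "AE x in K. ennreal \<bar>g x - m\<bar> = 0"
      by eventually_elim (use True g0 in \<open>auto simp: ennreal_eq_0_iff abs_of_nonneg\<close>)
    then have "(\<integral>\<^sup>+x. ennreal \<bar>g x - m\<bar> \<partial>K) = 0"
      by (subst nn_integral_0_iff_AE) auto
    then show ?thesis using True by simp
  next
    case False
    then have m: "0 < m" using m0 by simp
    have Gb: "a \<in> sets borel" if "a \<in> G" for a using that G(3) by auto
    have LD: "L = density K (\<lambda>x. ennreal (g x / m))"
    proof (rule measure_eqI_generator_eq[OF G(1), where \<Omega>=UNIV and A="\<lambda>_. UNIV"])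
      fix a assume a: "a \<in> G"
      then have [measurable]: "a \<in> sets borel" by (rule Gb)
      have "emeasure (density K (\<lambda>x. ennreal (g x / m))) a = (\<integral>\<^sup>+x. ennreal (1 / m) * (ennreal (g x) * indicator a x) \<partial>K)"
        by (subst emeasure_density) (auto intro!: nn_integral_cong simp: ennreal_mult'[symmetric] indicator_def g0 m0)
      also have "\<dots> = ennreal (1 / m) * (ennreal m * emeasure L a)"
        by (subst nn_integral_cmult) (auto simp: eq[OF a])
      also have "\<dots> = emeasure L a"
        using m by (simp add: mult.assoc[symmetric] ennreal_mult[symmetric])
      finally show "emeasure L a = emeasure (density K (\<lambda>x. ennreal (g x / m))) a" ..
    qed (use G L in auto)
    have KD: "K = density K (\<lambda>x. ennreal 1)"
      by (simp add: density_1)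
    have gi: "integrable K g"
      using gm g0 by (intro integrableI_nonneg) auto
    have "tv_dist L K = (\<integral>x. \<bar>g x / m - 1\<bar> \<partial>K)"
      by (subst LD, subst (2) KD, rule tv_dist_density) (use gi g0 m0 in auto)
    then have "m * tv_dist L K = (\<integral>x. m * \<bar>g x / m - 1\<bar> \<partial>K)"
      by simp
    also have "\<dots> = (\<integral>x. \<bar>g x - m\<bar> \<partial>K)"
    proof (rule Bochner_Integration.integral_cong[OF refl])
      fix x
      have "m * \<bar>g x / m - 1\<bar> = \<bar>m * (g x / m - 1)\<bar>" using m by (simp add: abs_mult)
      also have "m * (g x / m - 1) = g x - m" using m by (simp add: field_simps)
      finally show "m * \<bar>g x / m - 1\<bar> = \<bar>g x - m\<bar>" .
    qed
    finally show ?thesis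
      using gi by (subst nn_integral_eq_integral) auto
  qed
qed

text \<open>The Radon-Nikodym density of the law of \<open>R\<close> under \<open>P'\<close>
  relative to its law under \<open>P\<close>. Testing against functions of \<open>R\<close> compares
  these two laws alone, without any relation between \<open>P\<close> and \<open>P'\<close> as
  measures on their sample spaces.\<close>

definition is_image_density :: "'w measure \<Rightarrow> 'w measure \<Rightarrow> ('w \<Rightarrow> 's) \<Rightarrow> 's measure \<Rightarrow> ('s \<Rightarrow> real) \<Rightarrow> bool" where
  "is_image_density P P' R S g \<longleftrightarrow> g \<in> borel_measurable S \<and> (\<forall>x. 0 \<le> g x) \<and>
    (\<forall>f\<in>borel_measurable S. (\<integral>\<^sup>+\<omega>. f (R \<omega>) \<partial>P') = (\<integral>\<^sup>+\<omega>. ennreal (g (R \<omega>)) * f (R \<omega>) \<partial>P))"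

lemma image_densityD:
  assumes "is_image_density P P' R S g"
  shows "g \<in> borel_measurable S" and "0 \<le> g x"
    and "f \<in> borel_measurable S \<Longrightarrow>
      (\<integral>\<^sup>+\<omega>. f (R \<omega>) \<partial>P') = (\<integral>\<^sup>+\<omega>. ennreal (g (R \<omega>)) * f (R \<omega>) \<partial>P)"
  using assms unfolding is_image_density_def by auto

text \<open>Bayes' rule: \<open>L u\<close> is \<open>K u\<close> reweighted by
  \<open>g (x, u) / m u\<close>. Passing from \<open>P'\<close> to \<open>P\<close> for a function
  of \<open>U\<close> produces exactly the weight \<open>m\<close>, so the scaled distance appears;
  disintegration along \<open>K\<close> then merges the inner and the outer integral.\<close>

lemma integral_tv_dist_cond_kernels:
  fixes X :: "'w \<Rightarrow> 'x::polish_space"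
  assumes P: "prob_space P" and P': "prob_space P'"
    and K: "cond_kernel P borel X S U K" and L: "cond_kernel P' borel X S U L"
    and dg: "is_image_density P P' (\<lambda>\<omega>. (X \<omega>, U \<omega>)) (borel \<Otimes>\<^sub>M S) g"
    and dm: "is_image_density P P' U S m"
  shows "(\<integral>\<omega>. tv_dist (L (U \<omega>)) (K (U \<omega>)) \<partial>P') = (\<integral>\<omega>. \<bar>g (X \<omega>, U \<omega>) - m (U \<omega>)\<bar> \<partial>P)"
proof -
  interpret P: prob_space P by fact
  note g[measurable] = image_densityD(1)[OF dg] and g0 = image_densityD(2)[OF dg] and gd = image_densityD(3)[OF dg]
  note m[measurable] = image_densityD(1)[OF dm] and m0 = image_densityD(2)[OF dm] and md = image_densityD(3)[OF dm]
  have X[measurable]: "X \<in> P \<rightarrow>\<^sub>M borel" "X \<in> P' \<rightarrow>\<^sub>M borel" and U[measurable]: "U \<in> P \<rightarrow>\<^sub>M S" "U \<in> P' \<rightarrow>\<^sub>M S"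
    and Km[measurable]: "K \<in> S \<rightarrow>\<^sub>M prob_algebra borel" and Lm[measurable]: "L \<in> S \<rightarrow>\<^sub>M prob_algebra borel"
    using K L unfolding cond_kernel_def by auto
  have Lme[measurable]: "(\<lambda>u. emeasure (L u) a) \<in> borel_measurable S" if "a \<in> sets borel" for a
    using measurable_emeasure_kernel[OF measurable_prob_algebraD[OF Lm] that] .
  have tv[measurable]: "(\<lambda>u. tv_dist (L u) (K u)) \<in> borel_measurable S"
    by (rule measurable_tv_dist[OF Lm Km])
  define N where "N = distr P S U"
  interpret N: prob_space N unfolding N_def by (rule P.prob_space_distr) simp
  have sN[measurable_cong, simp]: "sets N = sets S" and spN: "space N = space S" by (simp_all add: N_def)
  obtain G :: "'x set set" where G: "countable G" "Int_stable G" "UNIV \<in> G" "sets borel = sigma_sets UNIV G"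
    by (rule exists_countable_generator)
  \<comment> \<open>Both sides are densities relative to \<open>N\<close> of the measure that sends
    \<open>b\<close> to the \<open>P'\<close>-probability of \<open>X \<in> a\<close> and
    \<open>U \<in> b\<close>: the left through \<open>m\<close> and the kernel \<open>L\<close>, the
    right through \<open>g\<close> and disintegration along \<open>K\<close>. Uniqueness of
    densities identifies them.\<close>
  have one: "AE u in N. ennreal (m u) * emeasure (L u) a = (\<integral>\<^sup>+x. ennreal (g (x, u)) * indicator a x \<partial>K u)"
    if a[measurable]: "a \<in> sets borel" for a
  proof (rule N.density_unique_finite_measure)
    have gm: "(\<lambda>u. \<integral>\<^sup>+x. ennreal (g (x, u)) * indicator a x \<partial>K u) \<in> borel_measurable S"
      using nn_integral_kernel_measurable[OF Km, of "\<lambda>(x, u). ennreal (g (x, u)) * indicator a x"] by simp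
    then show "(\<lambda>u. \<integral>\<^sup>+x. ennreal (g (x, u)) * indicator a x \<partial>K u) \<in> borel_measurable N" by simp
    show "(\<lambda>u. ennreal (m u) * emeasure (L u) a) \<in> borel_measurable N" by simp
    fix b assume "b \<in> sets N"
    then have b[measurable]: "b \<in> sets S" by simp
    have "(\<integral>\<^sup>+u. ennreal (m u) * emeasure (L u) a * indicator b u \<partial>N)
      = (\<integral>\<^sup>+\<omega>. ennreal (m (U \<omega>)) * (emeasure (L (U \<omega>)) a * indicator b (U \<omega>)) \<partial>P)"
      unfolding N_def by (subst nn_integral_distr) (auto simp: mult.assoc)
    also have "\<dots> = (\<integral>\<^sup>+\<omega>. emeasure (L (U \<omega>)) a * indicator b (U \<omega>) \<partial>P')"
      by (rule md[symmetric]) simp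
    also have "\<dots> = emeasure P' {\<omega> \<in> space P'. X \<omega> \<in> a \<and> U \<omega> \<in> b}"
      using L a b unfolding cond_kernel_def by (simp add: mult.commute)
    also have "\<dots> = (\<integral>\<^sup>+\<omega>. indicator (a \<times> b) (X \<omega>, U \<omega>) \<partial>P')"
    proof -
      have "{\<omega> \<in> space P'. X \<omega> \<in> a \<and> U \<omega> \<in> b} \<in> sets P'" by measurable
      then have "emeasure P' {\<omega> \<in> space P'. X \<omega> \<in> a \<and> U \<omega> \<in> b}
        = (\<integral>\<^sup>+\<omega>. indicator {\<omega> \<in> space P'. X \<omega> \<in> a \<and> U \<omega> \<in> b} \<omega> \<partial>P')"
        by simp
      also have "\<dots> = (\<integral>\<^sup>+\<omega>. indicator (a \<times> b) (X \<omega>, U \<omega>) \<partial>P')"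
        by (intro nn_integral_cong) (simp add: indicator_def)
      finally show ?thesis .
    qed
    also have "\<dots> = (\<integral>\<^sup>+\<omega>. ennreal (g (X \<omega>, U \<omega>)) * indicator (a \<times> b) (X \<omega>, U \<omega>) \<partial>P)"
      by (rule gd) simp
    also have "\<dots> = (\<integral>\<^sup>+\<omega>. \<integral>\<^sup>+x. ennreal (g (x, U \<omega>)) * indicator (a \<times> b) (x, U \<omega>) \<partial>K (U \<omega>) \<partial>P)"
      by (rule nn_integral_disintegration[OF P K, where f="\<lambda>z. ennreal (g z) * indicator (a \<times> b) z"]) simp
    also have "\<dots> = (\<integral>\<^sup>+\<omega>. (\<integral>\<^sup>+x. ennreal (g (x, U \<omega>)) * indicator a x \<partial>K (U \<omega>)) * indicator b (U \<omega>) \<partial>P)"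
      by (intro nn_integral_cong) (auto simp: indicator_def)
    also have "\<dots> = (\<integral>\<^sup>+u. (\<integral>\<^sup>+x. ennreal (g (x, u)) * indicator a x \<partial>K u) * indicator b u \<partial>N)"
      unfolding N_def using gm by (subst nn_integral_distr) auto
    finally show "(\<integral>\<^sup>+u. ennreal (m u) * emeasure (L u) a * indicator b u \<partial>N)
      = (\<integral>\<^sup>+u. (\<integral>\<^sup>+x. ennreal (g (x, u)) * indicator a x \<partial>K u) * indicator b u \<partial>N)" .
  qed auto
  \<comment> \<open>The null set in \<open>one\<close> depends on \<open>a\<close>, so the
    quantifier over sets can be moved inside only for the countable family \<open>G\<close>.\<close>
  have "AE u in N. \<forall>a\<in>G. ennreal (m u) * emeasure (L u) a = (\<integral>\<^sup>+x. ennreal (g (x, u)) * indicator a x \<partial>K u)"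
    using G(1,4) one by (subst AE_ball_countable) auto
  then have "AE u in N. ennreal (m u) * ennreal (tv_dist (L u) (K u)) = (\<integral>\<^sup>+x. ennreal \<bar>g (x, u) - m u\<bar> \<partial>K u)"
    using AE_space
  proof eventually_elim
    case (elim u)
    then have u[measurable]: "u \<in> space S" by (simp add: spN)
    have "ennreal (m u * tv_dist (L u) (K u)) = (\<integral>\<^sup>+x. ennreal \<bar>g (x, u) - m u\<bar> \<partial>K u)"
      by (rule tv_dist_of_scaled_density[OF prob_algebra_kernelD[OF Km u] prob_algebra_kernelD[OF Lm u] G(2,3,4)])
         (use elim g0 m0 in auto)
    then show ?case by (simp add: ennreal_mult' m0)
  qed
  note key = this
  have nn: "(\<integral>\<^sup>+\<omega>. ennreal (tv_dist (L (U \<omega>)) (K (U \<omega>))) \<partial>P') = (\<integral>\<^sup>+\<omega>. ennreal \<bar>g (X \<omega>, U \<omega>) - m (U \<omega>)\<bar> \<partial>P)"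
  proof -
    have km: "(\<lambda>u. \<integral>\<^sup>+x. ennreal \<bar>g (x, u) - m u\<bar> \<partial>K u) \<in> borel_measurable S"
      using nn_integral_kernel_measurable[OF Km, of "\<lambda>(x, u). ennreal \<bar>g (x, u) - m u\<bar>"] by simp
    have "(\<integral>\<^sup>+\<omega>. ennreal (tv_dist (L (U \<omega>)) (K (U \<omega>))) \<partial>P')
      = (\<integral>\<^sup>+\<omega>. ennreal (m (U \<omega>)) * ennreal (tv_dist (L (U \<omega>)) (K (U \<omega>))) \<partial>P)"
      by (rule md) simp
    also have "\<dots> = (\<integral>\<^sup>+u. ennreal (m u) * ennreal (tv_dist (L u) (K u)) \<partial>N)"
      unfolding N_def by (subst nn_integral_distr) auto
    also have "\<dots> = (\<integral>\<^sup>+u. \<integral>\<^sup>+x. ennreal \<bar>g (x, u) - m u\<bar> \<partial>K u \<partial>N)"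
      by (rule nn_integral_cong_AE[OF key])
    also have "\<dots> = (\<integral>\<^sup>+\<omega>. \<integral>\<^sup>+x. ennreal \<bar>g (x, U \<omega>) - m (U \<omega>)\<bar> \<partial>K (U \<omega>) \<partial>P)"
      unfolding N_def using km by (subst nn_integral_distr) auto
    also have "\<dots> = (\<integral>\<^sup>+\<omega>. ennreal \<bar>g (X \<omega>, U \<omega>) - m (U \<omega>)\<bar> \<partial>P)"
      using nn_integral_disintegration[OF P K, where f="\<lambda>(x, u). ennreal \<bar>g (x, u) - m u\<bar>"] by simp
    finally show ?thesis .
  qed
  have tv0: "0 \<le> tv_dist (L (U \<omega>)) (K (U \<omega>))" if "\<omega> \<in> space P'" for \<omega>
  proof -
    have u: "U \<omega> \<in> space S" using measurable_space[OF U(2) that] .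
    show ?thesis
      using prob_algebra_kernelD[OF Km u] prob_algebra_kernelD[OF Lm u] by (intro tv_dist_nonneg) auto
  qed
  have "(\<integral>\<omega>. tv_dist (L (U \<omega>)) (K (U \<omega>)) \<partial>P') = enn2real (\<integral>\<^sup>+\<omega>. ennreal (tv_dist (L (U \<omega>)) (K (U \<omega>))) \<partial>P')"
    using tv0 by (intro integral_eq_nn_integral) auto
  also have "\<dots> = (\<integral>\<omega>. \<bar>g (X \<omega>, U \<omega>) - m (U \<omega>)\<bar> \<partial>P)"
    unfolding nn by (intro integral_eq_nn_integral[symmetric]) auto
  finally show ?thesis .
qed

subsection \<open>Change of the initial law in a hidden Markov model\<close>

lemma is_rcd_imp_cond_kernel:
  assumes "is_rcd P X Y n I K" "X n \<in> P \<rightarrow>\<^sub>M borel" "\<And>i. i \<in> I \<Longrightarrow> Y i \<in> P \<rightarrow>\<^sub>M borel"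
  shows "cond_kernel P borel (X n) (PiM I (\<lambda>_. borel)) (\<lambda>\<omega>. \<lambda>i\<in>I. Y i \<omega>) K"
  using assms unfolding is_rcd_def cond_kernel_def by (auto intro!: measurable_restrict)

text \<open>The Markov property, with conditioning on the whole past although the kernel reads only
  its last coordinate. In this form the newest state can be integrated out by
  disintegration.\<close>

lemma hmm_transition_cond_kernel:
  assumes M: "hmm_model P \<mu> T Q X Z" and T: "T \<in> borel \<rightarrow>\<^sub>M prob_algebra borel"
  shows "cond_kernel P borel (X (Suc n)) (PiM {..n} (\<lambda>_. borel)) (\<lambda>\<omega>. \<lambda>i\<in>{..n}. X i \<omega>) (\<lambda>u. T (u n))"
proof -
  have X: "X i \<in> P \<rightarrow>\<^sub>M borel" for i using M by (simp add: hmm_model_def)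
  have "(\<lambda>u. T (u n)) \<in> PiM {..n} (\<lambda>_. borel) \<rightarrow>\<^sub>M prob_algebra borel"
    by (rule measurable_compose[OF _ T]) (simp add: measurable_component_singleton)
  moreover have "emeasure P {\<omega> \<in> space P. X (Suc n) \<omega> \<in> a \<and> (\<lambda>i\<in>{..n}. X i \<omega>) \<in> b}
      = (\<integral>\<^sup>+\<omega>. indicator b (\<lambda>i\<in>{..n}. X i \<omega>) * emeasure (T ((\<lambda>i\<in>{..n}. X i \<omega>) n)) a \<partial>P)"
    if "a \<in> sets borel" "b \<in> sets (PiM {..n} (\<lambda>_. borel))" for a b
    using M that unfolding hmm_model_def by (simp add: conj_commute)
  ultimately show ?thesis
    unfolding cond_kernel_def using X by (auto intro!: measurable_restrict)
qed

text \<open>Both chains move by the same kernel \<open>T\<close>. The last coordinate is integrated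
  out under \<mu>, the induction hypothesis exchanges the law of the shorter path at the cost of
  \<open>\<Lambda> (X 0 \<omega>)\<close>, and the same kernel restores the last coordinate under
  \<nu>.\<close>

lemma hmm_initial_change:
  fixes \<Lambda> :: "'x::polish_space \<Rightarrow> real"
  assumes T: "T \<in> borel \<rightarrow>\<^sub>M prob_algebra borel"
    and M\<mu>: "hmm_model P\<mu> \<mu> T Q X Z" and M\<nu>: "hmm_model P\<nu> \<nu> T Q X Z"
    and \<Lambda>[measurable]: "\<Lambda> \<in> borel_measurable borel" and \<mu>: "\<mu> = density \<nu> (\<lambda>x. ennreal (\<Lambda> x))"
    and "f \<in> borel_measurable (PiM {..n} (\<lambda>_. borel))"
  shows "(\<integral>\<^sup>+\<omega>. f (\<lambda>i\<in>{..n}. X i \<omega>) \<partial>P\<mu>) = (\<integral>\<^sup>+\<omega>. ennreal (\<Lambda> (X 0 \<omega>)) * f (\<lambda>i\<in>{..n}. X i \<omega>) \<partial>P\<nu>)"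
  using assms(6)
proof (induction n arbitrary: f)
  case 0
  note [measurable] = 0
  have [measurable]: "X 0 \<in> P\<mu> \<rightarrow>\<^sub>M borel" "X 0 \<in> P\<nu> \<rightarrow>\<^sub>M borel"
    and dm: "distr P\<mu> borel (X 0) = \<mu>" and dn: "distr P\<nu> borel (X 0) = \<nu>"
    using M\<mu> M\<nu> by (simp_all add: hmm_model_def)
  have sn[measurable_cong]: "sets \<nu> = sets borel" unfolding dn[symmetric] by simp
  have "(\<lambda>x. \<lambda>i\<in>{..0::nat}. x) \<in> borel \<rightarrow>\<^sub>M PiM {..0} (\<lambda>_. borel :: 'x measure)"
    by (intro measurable_restrict) simp
  from measurable_compose[OF this 0]
  have ph[measurable]: "(\<lambda>x. f (\<lambda>i\<in>{..0::nat}. x)) \<in> borel_measurable borel" .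
  have r: "(\<lambda>i\<in>{..0}. X i \<omega>) = (\<lambda>i\<in>{..0}. X 0 \<omega>)" for \<omega> by auto
  have "(\<integral>\<^sup>+\<omega>. f (\<lambda>i\<in>{..0}. X i \<omega>) \<partial>P\<mu>) = (\<integral>\<^sup>+x. f (\<lambda>i\<in>{..0}. x) \<partial>\<mu>)"
    unfolding r dm[symmetric] by (subst nn_integral_distr) (auto simp del: atMost_0)
  also have "\<dots> = (\<integral>\<^sup>+x. ennreal (\<Lambda> x) * f (\<lambda>i\<in>{..0}. x) \<partial>\<nu>)"
    unfolding \<mu> by (rule nn_integral_density) (auto simp del: atMost_0)
  also have "\<dots> = (\<integral>\<^sup>+\<omega>. ennreal (\<Lambda> (X 0 \<omega>)) * f (\<lambda>i\<in>{..0}. X i \<omega>) \<partial>P\<nu>)"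
    unfolding r dn[symmetric] by (subst nn_integral_distr) (auto simp del: atMost_0)
  finally show ?case .
next
  case (Suc n)
  note f[measurable] = Suc.prems
  let ?S = "PiM {..n} (\<lambda>_. borel :: 'x measure)" and ?U = "\<lambda>\<omega>. \<lambda>i\<in>{..n}. X i \<omega>"
  have P: "prob_space P\<mu>" "prob_space P\<nu>" using M\<mu> M\<nu> by (simp_all add: hmm_model_def)
  note km = hmm_transition_cond_kernel[OF M\<mu> T, of n] and kn = hmm_transition_cond_kernel[OF M\<nu> T, of n]
  have K: "(\<lambda>u. T (u n)) \<in> ?S \<rightarrow>\<^sub>M prob_algebra borel" using km by (simp add: cond_kernel_def)
  have upd: "(\<lambda>w. (snd w)(Suc n := fst w)) \<in> borel \<Otimes>\<^sub>M ?S \<rightarrow>\<^sub>M PiM {..Suc n} (\<lambda>_. borel)"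
    unfolding atMost_Suc by measurable
  define f' where "f' w = f ((snd w)(Suc n := fst w))" for w
  have [measurable]: "f' \<in> borel_measurable (borel \<Otimes>\<^sub>M ?S)"
    unfolding f'_def by (rule measurable_compose[OF upd f])
  have r: "f (\<lambda>i\<in>{..Suc n}. X i \<omega>) = f' (X (Suc n) \<omega>, ?U \<omega>)" for \<omega>
    unfolding f'_def by (auto intro!: arg_cong[where f=f])
  have Hm: "(\<lambda>u. \<integral>\<^sup>+x. f' (x, u) \<partial>T (u n)) \<in> borel_measurable ?S"
    by (rule nn_integral_kernel_measurable[OF K]) simp
  have [measurable]: "(\<lambda>u. u 0) \<in> ?S \<rightarrow>\<^sub>M borel"
    by (simp add: measurable_component_singleton)
  have "(\<integral>\<^sup>+\<omega>. f (\<lambda>i\<in>{..Suc n}. X i \<omega>) \<partial>P\<mu>) = (\<integral>\<^sup>+\<omega>. \<integral>\<^sup>+x. f' (x, ?U \<omega>) \<partial>T (?U \<omega> n) \<partial>P\<mu>)"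
    unfolding r by (rule nn_integral_disintegration[OF P(1) km]) simp
  also have "\<dots> = (\<integral>\<^sup>+\<omega>. ennreal (\<Lambda> (X 0 \<omega>)) * (\<integral>\<^sup>+x. f' (x, ?U \<omega>) \<partial>T (?U \<omega> n)) \<partial>P\<nu>)"
    by (rule Suc.IH[OF Hm])
  \<comment> \<open>The weight is rewritten as \<open>\<Lambda> (?U \<omega> 0)\<close>, a function
    of the conditioning path. It can then be drawn into the inner integral, so that the
    disintegration under \<open>P\<nu>\<close> applies to the product.\<close>
  also have "\<dots> = (\<integral>\<^sup>+\<omega>. \<integral>\<^sup>+x. ennreal (\<Lambda> (?U \<omega> 0)) * f' (x, ?U \<omega>) \<partial>T (?U \<omega> n) \<partial>P\<nu>)"
  proof (rule nn_integral_cong)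
    fix \<omega> assume "\<omega> \<in> space P\<nu>"
    then have U: "?U \<omega> \<in> space ?S" by (simp add: space_PiM)
    have "sets (T (?U \<omega> n)) = sets borel" using prob_algebra_kernelD[OF K U] by simp
    then have "(\<lambda>x. f' (x, ?U \<omega>)) \<in> borel_measurable (T (?U \<omega> n))"
      using U by (simp cong: measurable_cong_sets)
    then show "ennreal (\<Lambda> (X 0 \<omega>)) * (\<integral>\<^sup>+x. f' (x, ?U \<omega>) \<partial>T (?U \<omega> n))
      = (\<integral>\<^sup>+x. ennreal (\<Lambda> (?U \<omega> 0)) * f' (x, ?U \<omega>) \<partial>T (?U \<omega> n))"
      by (simp add: nn_integral_cmult)
  qed
  also have "\<dots> = (\<integral>\<^sup>+\<omega>. ennreal (\<Lambda> (?U \<omega> 0)) * f' (X (Suc n) \<omega>, ?U \<omega>) \<partial>P\<nu>)"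
    using nn_integral_disintegration[OF P(2) kn, of "\<lambda>(x, u). ennreal (\<Lambda> (u 0)) * f' (x, u)"] by simp
  also have "\<dots> = (\<integral>\<^sup>+\<omega>. ennreal (\<Lambda> (X 0 \<omega>)) * f (\<lambda>i\<in>{..Suc n}. X i \<omega>) \<partial>P\<nu>)"
    unfolding r by simp
  finally show ?case .
qed

text \<open>Cylinder sets determine a finite measure on the path space, and each involves only
  coordinates up to some \<open>n\<close>. The finite-horizon formulas fit together because their
  weight is the same for all \<open>n\<close>.\<close>

lemma hmm_path_law_density:
  fixes \<Lambda> :: "'x::polish_space \<Rightarrow> real"
  assumes T: "T \<in> borel \<rightarrow>\<^sub>M prob_algebra borel"
    and M\<mu>: "hmm_model P\<mu> \<mu> T Q X Z" and M\<nu>: "hmm_model P\<nu> \<nu> T Q X Z"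
    and \<Lambda>[measurable]: "\<Lambda> \<in> borel_measurable borel" and \<mu>: "\<mu> = density \<nu> (\<lambda>x. ennreal (\<Lambda> x))"
  shows "distr P\<mu> (PiM UNIV (\<lambda>_. borel)) (\<lambda>\<omega> n. X n \<omega>)
    = density (distr P\<nu> (PiM UNIV (\<lambda>_. borel)) (\<lambda>\<omega> n. X n \<omega>)) (\<lambda>x. ennreal (\<Lambda> (x 0)))"
    (is "?L = ?R")
proof (rule measure_eqI_PiM_infinite[where I=UNIV and M="\<lambda>_. borel"])
  have X[measurable]: "X i \<in> P\<mu> \<rightarrow>\<^sub>M borel" "X i \<in> P\<nu> \<rightarrow>\<^sub>M borel" for i
    using M\<mu> M\<nu> by (simp_all add: hmm_model_def)
  have path[measurable]: "(\<lambda>\<omega> n. X n \<omega>) \<in> P\<mu> \<rightarrow>\<^sub>M PiM UNIV (\<lambda>_. borel)" "(\<lambda>\<omega> n. X n \<omega>) \<in> P\<nu> \<rightarrow>\<^sub>M PiM UNIV (\<lambda>_. borel)"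
    by (intro measurable_PiM_single'; simp)+
  interpret P\<mu>: prob_space P\<mu> using M\<mu> by (simp add: hmm_model_def)
  show "finite_measure ?L" by (rule P\<mu>.finite_measure_distr) simp
  fix A :: "nat \<Rightarrow> 'x set" and J :: "nat set"
  assume J: "finite J" and A[measurable]: "\<And>i. i \<in> J \<Longrightarrow> A i \<in> sets borel"
  obtain n where n: "J \<subseteq> {..n}" using finite_nat_iff_bounded_le J by blast
  define E where "E = prod_emb UNIV (\<lambda>_. borel) J (Pi\<^sub>E J A)"
  have [measurable]: "E \<in> sets (PiM UNIV (\<lambda>_. borel))"
    unfolding E_def using J A by (intro sets_PiM_I) auto
  define f where "f u = (\<Prod>i\<in>J. indicator (A i) (u i) :: ennreal)" for u :: "nat \<Rightarrow> 'x"
  have fm: "f \<in> borel_measurable (PiM {..n} (\<lambda>_. borel))"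
    unfolding f_def
  proof (rule borel_measurable_prod_ennreal)
    fix i assume i: "i \<in> J"
    then have "(\<lambda>u. u i) \<in> PiM {..n} (\<lambda>_. borel) \<rightarrow>\<^sub>M (borel :: 'x measure)"
      using n by (intro measurable_component_singleton) auto
    then show "(\<lambda>u. indicator (A i) (u i) :: ennreal) \<in> borel_measurable (PiM {..n} (\<lambda>_. borel))"
      using A[OF i] by measurable
  qed
  have Ef: "indicator E (\<lambda>n. X n \<omega>) = f (\<lambda>i\<in>{..n}. X i \<omega>)" for \<omega>
  proof -
    have "f (\<lambda>i\<in>{..n}. X i \<omega>) = (\<Prod>i\<in>J. indicator (A i) (X i \<omega>))"
      unfolding f_def using n by (intro prod.cong) auto
    also have "\<dots> = indicator E (\<lambda>n. X n \<omega>)"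
      using J by (auto simp: E_def prod_emb_def indicator_def PiE_iff space_PiM)
    finally show ?thesis by simp
  qed
  have "emeasure ?L E = (\<integral>\<^sup>+\<omega>. indicator E (\<lambda>n. X n \<omega>) \<partial>P\<mu>)"
    by (subst nn_integral_indicator[symmetric], simp, subst nn_integral_distr) auto
  also have "\<dots> = (\<integral>\<^sup>+\<omega>. ennreal (\<Lambda> (X 0 \<omega>)) * indicator E (\<lambda>n. X n \<omega>) \<partial>P\<nu>)"
    unfolding Ef by (rule hmm_initial_change[OF T M\<mu> M\<nu> \<Lambda> \<mu> fm])
  also have "\<dots> = emeasure ?R E"
    by (subst emeasure_density, simp, simp, subst nn_integral_distr) auto
  finally show "emeasure ?L E = emeasure ?R E" .
qed simp_all

text \<open>Independence of chain and noise in the form of Fubini's theorem: the path is frozen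
  while the noise is integrated out.\<close>

lemma hmm_nn_integral:
  fixes X :: "nat \<Rightarrow> 'w \<Rightarrow> 'x::polish_space" and Z :: "nat \<Rightarrow> 'w \<Rightarrow> 'z::polish_space"
  assumes M: "hmm_model P \<mu> T Q X Z"
    and f[measurable]: "f \<in> borel_measurable (PiM UNIV (\<lambda>_. borel) \<Otimes>\<^sub>M PiM UNIV (\<lambda>_. borel))"
  shows "(\<integral>\<^sup>+\<omega>. f (\<lambda>n. X n \<omega>, \<lambda>n. Z n \<omega>) \<partial>P)
    = (\<integral>\<^sup>+x. \<integral>\<^sup>+\<omega>. f (x, \<lambda>n. Z n \<omega>) \<partial>P \<partial>distr P (PiM UNIV (\<lambda>_. borel)) (\<lambda>\<omega> n. X n \<omega>))"
proof -
  let ?X = "PiM UNIV (\<lambda>_::nat. borel :: 'x measure)" and ?Z = "PiM UNIV (\<lambda>_::nat. borel :: 'z measure)"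
  have X[measurable]: "X i \<in> P \<rightarrow>\<^sub>M borel" "Z i \<in> P \<rightarrow>\<^sub>M borel" for i
    using M by (simp_all add: hmm_model_def)
  have path[measurable]: "(\<lambda>\<omega> n. X n \<omega>) \<in> P \<rightarrow>\<^sub>M ?X" "(\<lambda>\<omega> n. Z n \<omega>) \<in> P \<rightarrow>\<^sub>M ?Z"
    by (intro measurable_PiM_single'; simp)+
  interpret P: prob_space P using M by (simp add: hmm_model_def)
  interpret LZ: prob_space "distr P ?Z (\<lambda>\<omega> n. Z n \<omega>)" by (rule P.prob_space_distr) simp
  have "(\<integral>\<^sup>+\<omega>. f (\<lambda>n. X n \<omega>, \<lambda>n. Z n \<omega>) \<partial>P) = (\<integral>\<^sup>+z. f z \<partial>distr P (?X \<Otimes>\<^sub>M ?Z) (\<lambda>\<omega>. (\<lambda>n. X n \<omega>, \<lambda>n. Z n \<omega>)))"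
    by (subst nn_integral_distr) auto
  also have "\<dots> = (\<integral>\<^sup>+z. f z \<partial>(distr P ?X (\<lambda>\<omega> n. X n \<omega>) \<Otimes>\<^sub>M distr P ?Z (\<lambda>\<omega> n. Z n \<omega>)))"
    using M by (simp add: hmm_model_def)
  also have "\<dots> = (\<integral>\<^sup>+x. \<integral>\<^sup>+z. f (x, z) \<partial>distr P ?Z (\<lambda>\<omega> n. Z n \<omega>) \<partial>distr P ?X (\<lambda>\<omega> n. X n \<omega>))"
    by (rule LZ.nn_integral_fst[symmetric]) simp
  also have "\<dots> = (\<integral>\<^sup>+x. \<integral>\<^sup>+\<omega>. f (x, \<lambda>n. Z n \<omega>) \<partial>P \<partial>distr P ?X (\<lambda>\<omega> n. X n \<omega>))"
    by (intro nn_integral_cong, subst nn_integral_distr) auto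
  finally show ?thesis .
qed

text \<open>The right-hand side depends only on \<open>Q\<close>, so the noise sequence has the same
  law in the two models.\<close>

lemma hmm_noise_law:
  fixes X :: "nat \<Rightarrow> 'w \<Rightarrow> 'x::polish_space" and Z :: "nat \<Rightarrow> 'w \<Rightarrow> 'z::polish_space"
  assumes M: "hmm_model P \<mu> T Q X Z"
  shows "distr P (PiM UNIV (\<lambda>_. borel)) (\<lambda>\<omega> n. Z n \<omega>) = PiM UNIV (\<lambda>_. Q)"
proof -
  interpret P: prob_space P using M by (simp add: hmm_model_def)
  have Z: "Z i \<in> P \<rightarrow>\<^sub>M borel" "distr P borel (Z i) = Q" for i using M by (simp_all add: hmm_model_def)
  have "P.indep_vars (\<lambda>_. borel) Z UNIV" using M by (simp add: hmm_model_def)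
  then show ?thesis
    using P.indep_vars_iff_distr_eq_PiM'[of UNIV Z "\<lambda>_. borel"] Z by (simp add: restrict_UNIV)
qed

text \<open>For a frozen path the noise integral is the same in both models, so by Fubini only the
  path law has to be exchanged, and its density depends on the initial state alone.\<close>

lemma hmm_change_of_measure:
  fixes X :: "nat \<Rightarrow> 'w \<Rightarrow> 'x::polish_space" and Z :: "nat \<Rightarrow> 'w \<Rightarrow> 'z::polish_space"
    and \<Lambda> :: "'x \<Rightarrow> real"
  assumes T: "T \<in> borel \<rightarrow>\<^sub>M prob_algebra borel"
    and M\<mu>: "hmm_model P\<mu> \<mu> T Q X Z" and M\<nu>: "hmm_model P\<nu> \<nu> T Q X Z"
    and \<Lambda>[measurable]: "\<Lambda> \<in> borel_measurable borel" and \<mu>: "\<mu> = density \<nu> (\<lambda>x. ennreal (\<Lambda> x))"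
    and f[measurable]: "f \<in> borel_measurable (PiM UNIV (\<lambda>_. borel) \<Otimes>\<^sub>M PiM UNIV (\<lambda>_. borel))"
  shows "(\<integral>\<^sup>+\<omega>. f (\<lambda>n. X n \<omega>, \<lambda>n. Z n \<omega>) \<partial>P\<mu>)
    = (\<integral>\<^sup>+\<omega>. ennreal (\<Lambda> (X 0 \<omega>)) * f (\<lambda>n. X n \<omega>, \<lambda>n. Z n \<omega>) \<partial>P\<nu>)"
proof -
  let ?X = "PiM UNIV (\<lambda>_::nat. borel :: 'x measure)" and ?Z = "PiM UNIV (\<lambda>_::nat. borel :: 'z measure)"
  define L\<mu> where "L\<mu> = distr P\<mu> ?X (\<lambda>\<omega> n. X n \<omega>)"
  define L\<nu> where "L\<nu> = distr P\<nu> ?X (\<lambda>\<omega> n. X n \<omega>)"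
  have Ld: "L\<mu> = density L\<nu> (\<lambda>x. ennreal (\<Lambda> (x 0)))"
    unfolding L\<mu>_def L\<nu>_def by (rule hmm_path_law_density[OF T M\<mu> M\<nu> \<Lambda> \<mu>])
  have [measurable_cong, simp]: "sets L\<nu> = sets ?X" and sp: "space L\<nu> = space ?X" by (simp_all add: L\<nu>_def)
  have X[measurable]: "Z i \<in> P\<mu> \<rightarrow>\<^sub>M borel" "Z i \<in> P\<nu> \<rightarrow>\<^sub>M borel" for i
    using M\<mu> M\<nu> by (simp_all add: hmm_model_def)
  have path[measurable]: "(\<lambda>\<omega> n. Z n \<omega>) \<in> P\<mu> \<rightarrow>\<^sub>M ?Z" "(\<lambda>\<omega> n. Z n \<omega>) \<in> P\<nu> \<rightarrow>\<^sub>M ?Z"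
    by (intro measurable_PiM_single'; simp)+
  interpret P\<nu>: prob_space P\<nu> using M\<nu> by (simp add: hmm_model_def)
  interpret LZ: prob_space "distr P\<nu> ?Z (\<lambda>\<omega> n. Z n \<omega>)" by (rule P\<nu>.prob_space_distr) simp
  have eqZ: "(\<integral>\<^sup>+\<omega>. f (x, \<lambda>n. Z n \<omega>) \<partial>P\<mu>) = (\<integral>\<^sup>+\<omega>. f (x, \<lambda>n. Z n \<omega>) \<partial>P\<nu>)" if x[measurable]: "x \<in> space ?X" for x
  proof -
    have "(\<integral>\<^sup>+\<omega>. f (x, \<lambda>n. Z n \<omega>) \<partial>P\<mu>) = (\<integral>\<^sup>+z. f (x, z) \<partial>distr P\<mu> ?Z (\<lambda>\<omega> n. Z n \<omega>))"
      by (subst nn_integral_distr) auto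
    also have "\<dots> = (\<integral>\<^sup>+z. f (x, z) \<partial>distr P\<nu> ?Z (\<lambda>\<omega> n. Z n \<omega>))"
      by (simp only: hmm_noise_law[OF M\<mu>] hmm_noise_law[OF M\<nu>])
    also have "\<dots> = (\<integral>\<^sup>+\<omega>. f (x, \<lambda>n. Z n \<omega>) \<partial>P\<nu>)"
      by (subst nn_integral_distr) auto
    finally show ?thesis .
  qed
  have inner: "(\<lambda>x. \<integral>\<^sup>+\<omega>. f (x, \<lambda>n. Z n \<omega>) \<partial>P\<nu>) \<in> borel_measurable ?X"
    using P\<nu>.borel_measurable_nn_integral[of "\<lambda>x \<omega>. f (x, \<lambda>n. Z n \<omega>)" ?X] by simp
  have x0[measurable]: "(\<lambda>x. x 0) \<in> ?X \<rightarrow>\<^sub>M borel" by simp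
  have "(\<integral>\<^sup>+\<omega>. f (\<lambda>n. X n \<omega>, \<lambda>n. Z n \<omega>) \<partial>P\<mu>) = (\<integral>\<^sup>+x. \<integral>\<^sup>+\<omega>. f (x, \<lambda>n. Z n \<omega>) \<partial>P\<mu> \<partial>L\<mu>)"
    unfolding L\<mu>_def by (rule hmm_nn_integral[OF M\<mu> f])
  also have "\<dots> = (\<integral>\<^sup>+x. \<integral>\<^sup>+\<omega>. f (x, \<lambda>n. Z n \<omega>) \<partial>P\<nu> \<partial>L\<mu>)"
    by (intro nn_integral_cong eqZ) (simp add: L\<mu>_def)
  also have "\<dots> = (\<integral>\<^sup>+x. ennreal (\<Lambda> (x 0)) * (\<integral>\<^sup>+\<omega>. f (x, \<lambda>n. Z n \<omega>) \<partial>P\<nu>) \<partial>L\<nu>)"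
    unfolding Ld using inner by (subst nn_integral_density) auto
  also have "\<dots> = (\<integral>\<^sup>+x. \<integral>\<^sup>+\<omega>. ennreal (\<Lambda> (x 0)) * f (x, \<lambda>n. Z n \<omega>) \<partial>P\<nu> \<partial>L\<nu>)"
    by (intro nn_integral_cong nn_integral_cmult[symmetric]) (simp add: sp)
  also have "\<dots> = (\<integral>\<^sup>+\<omega>. ennreal (\<Lambda> (X 0 \<omega>)) * f (\<lambda>n. X n \<omega>, \<lambda>n. Z n \<omega>) \<partial>P\<nu>)"
    unfolding L\<nu>_def
    using hmm_nn_integral[OF M\<nu>, of "\<lambda>(x, z). ennreal (\<Lambda> (x 0)) * f (x, z)"] by simp
  finally show ?thesis .
qed

text \<open>The constant kernel expresses that \<open>Z n\<close> is independent of every function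
  \<open>\<psi>\<close> of the full path and the earlier noise. This is what makes the newest
  observation uninformative about the past once the current state is known.\<close>

lemma hmm_noise_independent:
  fixes X :: "nat \<Rightarrow> 'w \<Rightarrow> 'x::polish_space" and Z :: "nat \<Rightarrow> 'w \<Rightarrow> 'z::polish_space"
  assumes M: "hmm_model P \<mu> T Q X Z"
    and \<psi>[measurable]: "\<psi> \<in> PiM UNIV (\<lambda>_. borel) \<Otimes>\<^sub>M PiM {..<n} (\<lambda>_. borel) \<rightarrow>\<^sub>M S"
  shows "cond_kernel P borel (Z n) S (\<lambda>\<omega>. \<psi> (\<lambda>i. X i \<omega>, \<lambda>i\<in>{..<n}. Z i \<omega>)) (\<lambda>_. Q)"
proof -
  let ?X = "PiM UNIV (\<lambda>_::nat. borel :: 'x measure)" and ?Z = "PiM UNIV (\<lambda>_::nat. borel :: 'z measure)"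
  let ?Zn = "PiM {..<n} (\<lambda>_. borel :: 'z measure)"
  interpret P: prob_space P using M by (simp add: hmm_model_def)
  have X[measurable]: "X i \<in> P \<rightarrow>\<^sub>M borel" "Z i \<in> P \<rightarrow>\<^sub>M borel" and Q: "distr P borel (Z i) = Q" for i
    using M by (simp_all add: hmm_model_def)
  have path[measurable]: "(\<lambda>\<omega> n. X n \<omega>) \<in> P \<rightarrow>\<^sub>M ?X" "(\<lambda>\<omega> n. Z n \<omega>) \<in> P \<rightarrow>\<^sub>M ?Z"
    by (intro measurable_PiM_single'; simp)+
  have rs[measurable]: "(\<lambda>z. \<lambda>i\<in>{..<n}. z i) \<in> ?Z \<rightarrow>\<^sub>M ?Zn"
    by (intro measurable_restrict) simp
  have rZ[measurable]: "(\<lambda>\<omega>. \<lambda>i\<in>{..<n}. Z i \<omega>) \<in> P \<rightarrow>\<^sub>M ?Zn"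
    by (intro measurable_restrict) simp
  have pQ: "Q \<in> space (prob_algebra borel)"
    using P.prob_space_distr[OF X(2)[of n]] Q[of n] sets_distr[of P borel "Z n"] by (simp add: space_prob_algebra)
  have iv: "P.indep_vars (\<lambda>_. borel) Z UNIV" using M by (simp add: hmm_model_def)
  have "P.indep_var ?Zn (\<lambda>\<omega>. restrict (\<lambda>i. Z i \<omega>) {..<n}) (PiM {n} (\<lambda>_. borel)) (\<lambda>\<omega>. restrict (\<lambda>i. Z i \<omega>) {n})"
    by (rule P.indep_var_restrict[OF iv]) auto
  note ind = P.indep_varD[OF this]
  have split: "(\<integral>\<^sup>+\<omega>. indicator d (\<lambda>i\<in>{..<n}. Z i \<omega>) * indicator a (Z n \<omega>) \<partial>P)
      = (\<integral>\<^sup>+\<omega>. indicator d (\<lambda>i\<in>{..<n}. Z i \<omega>) \<partial>P) * emeasure Q a"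
    if d[measurable]: "d \<in> sets ?Zn" and a[measurable]: "a \<in> sets borel" for d a
  proof -
    let ?D = "(\<lambda>\<omega>. \<lambda>i\<in>{..<n}. Z i \<omega>) -` d \<inter> space P" and ?A = "Z n -` a \<inter> space P"
    \<comment> \<open>Independence of disjoint blocks of the noise speaks of vectors, so the event
      for \<open>Z n\<close> is lifted to vectors indexed by the singleton
      \<open>{n}\<close>.\<close>
    let ?a = "{f \<in> space (PiM {n} (\<lambda>_. borel)). f n \<in> a}"
    have a': "?a \<in> sets (PiM {n} (\<lambda>_. borel))"
      by (intro measurable_sets_Collect[OF measurable_component_singleton[of n]]) auto
    have D[measurable]: "?D \<in> sets P" "?A \<in> sets P"
      using measurable_sets[OF rZ d] measurable_sets[OF X(2) a] by auto
    have "(\<lambda>\<omega>. restrict (\<lambda>i. Z i \<omega>) {n}) -` ?a \<inter> space P = ?A"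
      by (auto simp: space_PiM)
    moreover have "(\<lambda>\<omega>. (restrict (\<lambda>i. Z i \<omega>) {..<n}, restrict (\<lambda>i. Z i \<omega>) {n})) -` (d \<times> ?a) \<inter> space P = ?D \<inter> ?A"
      by (auto simp: space_PiM)
    ultimately have prob: "P.prob (?D \<inter> ?A) = P.prob ?D * P.prob ?A"
      using ind[OF d a'] by simp
    have "(\<integral>\<^sup>+\<omega>. indicator d (\<lambda>i\<in>{..<n}. Z i \<omega>) * indicator a (Z n \<omega>) \<partial>P) = (\<integral>\<^sup>+\<omega>. indicator (?D \<inter> ?A) \<omega> \<partial>P)"
      by (intro nn_integral_cong) (simp add: indicator_def)
    also have "\<dots> = emeasure P ?D * emeasure P ?A"
      using D by (simp add: P.emeasure_eq_measure prob ennreal_mult)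
    also have "emeasure P ?A = emeasure Q a"
      unfolding Q[of n, symmetric] by (subst emeasure_distr) auto
    also have "emeasure P ?D = (\<integral>\<^sup>+\<omega>. indicator ?D \<omega> \<partial>P)"
      using D by simp
    also have "\<dots> = (\<integral>\<^sup>+\<omega>. indicator d (\<lambda>i\<in>{..<n}. Z i \<omega>) \<partial>P)"
      by (intro nn_integral_cong) (simp add: indicator_def)
    finally show ?thesis .
  qed
  have eq: "emeasure P {\<omega> \<in> space P. Z n \<omega> \<in> a \<and> \<psi> (\<lambda>i. X i \<omega>, \<lambda>i\<in>{..<n}. Z i \<omega>) \<in> b}
      = (\<integral>\<^sup>+\<omega>. indicator b (\<psi> (\<lambda>i. X i \<omega>, \<lambda>i\<in>{..<n}. Z i \<omega>)) * emeasure Q a \<partial>P)"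
    if a[measurable]: "a \<in> sets borel" and b[measurable]: "b \<in> sets S" for a b
  proof -
    let ?c = "\<lambda>x. {u \<in> space ?Zn. \<psi> (x, u) \<in> b}"
    have c[measurable]: "?c x \<in> sets ?Zn" if "x \<in> space ?X" for x
      using that by measurable
    have "{\<omega> \<in> space P. Z n \<omega> \<in> a \<and> \<psi> (\<lambda>i. X i \<omega>, \<lambda>i\<in>{..<n}. Z i \<omega>) \<in> b} \<in> sets P"
      by measurable
    then have "emeasure P {\<omega> \<in> space P. Z n \<omega> \<in> a \<and> \<psi> (\<lambda>i. X i \<omega>, \<lambda>i\<in>{..<n}. Z i \<omega>) \<in> b}
      = (\<integral>\<^sup>+\<omega>. indicator {\<omega> \<in> space P. Z n \<omega> \<in> a \<and> \<psi> (\<lambda>i. X i \<omega>, \<lambda>i\<in>{..<n}. Z i \<omega>) \<in> b} \<omega> \<partial>P)"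
      by simp
    also have "\<dots> = (\<integral>\<^sup>+\<omega>. indicator b (\<psi> (\<lambda>i. X i \<omega>, \<lambda>i\<in>{..<n}. Z i \<omega>)) * indicator a (Z n \<omega>) \<partial>P)"
      by (intro nn_integral_cong) (auto simp: indicator_def)
    also have "\<dots> = (\<integral>\<^sup>+x. \<integral>\<^sup>+\<omega>. indicator b (\<psi> (x, \<lambda>i\<in>{..<n}. Z i \<omega>)) * indicator a (Z n \<omega>) \<partial>P \<partial>distr P ?X (\<lambda>\<omega> n. X n \<omega>))"
      using hmm_nn_integral[OF M, of "\<lambda>(x, z). indicator b (\<psi> (x, \<lambda>i\<in>{..<n}. z i)) * indicator a (z n)"] by simp
    also have "\<dots> = (\<integral>\<^sup>+x. \<integral>\<^sup>+\<omega>. indicator b (\<psi> (x, \<lambda>i\<in>{..<n}. Z i \<omega>)) * emeasure Q a \<partial>P \<partial>distr P ?X (\<lambda>\<omega> n. X n \<omega>))"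
    proof (rule nn_integral_cong)
      fix x assume "x \<in> space (distr P ?X (\<lambda>\<omega> n. X n \<omega>))"
      then have x[measurable]: "x \<in> space ?X" by simp
      \<comment> \<open>With the path frozen at \<open>x\<close>, the event about
        \<open>\<psi>\<close> concerns the earlier noise only, and \<open>split\<close> separates it
        from \<open>Z n\<close>.\<close>
      have i: "indicator b (\<psi> (x, \<lambda>i\<in>{..<n}. Z i \<omega>)) = (indicator (?c x) (\<lambda>i\<in>{..<n}. Z i \<omega>) :: ennreal)" for \<omega>
        by (simp add: indicator_def space_PiM)
      show "(\<integral>\<^sup>+\<omega>. indicator b (\<psi> (x, \<lambda>i\<in>{..<n}. Z i \<omega>)) * indicator a (Z n \<omega>) \<partial>P)
        = (\<integral>\<^sup>+\<omega>. indicator b (\<psi> (x, \<lambda>i\<in>{..<n}. Z i \<omega>)) * emeasure Q a \<partial>P)"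
        unfolding i split[OF c[OF x] a]
        by (rule nn_integral_multc[symmetric]) (use c[OF x] in measurable)
    qed
    also have "\<dots> = (\<integral>\<^sup>+\<omega>. indicator b (\<psi> (\<lambda>i. X i \<omega>, \<lambda>i\<in>{..<n}. Z i \<omega>)) * emeasure Q a \<partial>P)"
      using hmm_nn_integral[OF M, of "\<lambda>(x, z). indicator b (\<psi> (x, \<lambda>i\<in>{..<n}. z i)) * emeasure Q a"] by simp
    finally show ?thesis .
  qed
  show ?thesis
    unfolding cond_kernel_def using eq pQ by auto
qed

subsection \<open>Filter and predictor stability\<close>

text \<open>The weight \<open>w\<close> may depend on more than \<open>R\<close>; it shows that null
  sets of the law of \<open>R\<close> under \<open>P\<close> are null under \<open>P'\<close>, and
  Radon-Nikodym supplies \<open>g\<close>. Composed with \<open>R\<close>, this \<open>g\<close> is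
  a version of the conditional expectation of \<open>w\<close> given \<open>R\<close>, already
  factored through \<open>R\<close>.\<close>

lemma exists_image_density:
  assumes P: "prob_space P" and P': "prob_space P'"
    and R[measurable]: "R \<in> P \<rightarrow>\<^sub>M S" "R \<in> P' \<rightarrow>\<^sub>M S"
    and w[measurable]: "w \<in> borel_measurable P"
    and eq: "\<And>f. f \<in> borel_measurable S \<Longrightarrow> (\<integral>\<^sup>+\<omega>. f (R \<omega>) \<partial>P') = (\<integral>\<^sup>+\<omega>. w \<omega> * f (R \<omega>) \<partial>P)"
  shows "\<exists>g. is_image_density P P' R S g"
proof -
  interpret J: prob_space "distr P S R" by (rule prob_space.prob_space_distr[OF P R(1)])
  interpret J': prob_space "distr P' S R" by (rule prob_space.prob_space_distr[OF P' R(2)])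
  have "absolutely_continuous (distr P S R) (distr P' S R)"
    unfolding absolutely_continuous_def
  proof
    fix A assume A: "A \<in> null_sets (distr P S R)"
    then have [measurable]: "A \<in> sets S" by auto
    have "AE \<omega> in P. R \<omega> \<notin> A"
      using AE_not_in[OF A] by (subst (asm) AE_distr_iff) auto
    then have "(\<integral>\<^sup>+\<omega>. w \<omega> * indicator A (R \<omega>) \<partial>P) = (\<integral>\<^sup>+\<omega>. 0 \<partial>P)"
      by (intro nn_integral_cong_AE) (auto elim!: eventually_mono simp: indicator_def)
    then have "(\<integral>\<^sup>+\<omega>. indicator A (R \<omega>) \<partial>P') = 0"
      using eq[of "indicator A"] by simp
    then have "emeasure (distr P' S R) A = 0"
      by (subst nn_integral_indicator[symmetric], simp, subst nn_integral_distr) auto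
    then show "A \<in> null_sets (distr P' S R)" by (auto intro: null_setsI)
  qed
  then obtain g :: "_ \<Rightarrow> real" where g[measurable]: "g \<in> borel_measurable (distr P S R)" and g0: "\<And>x. 0 \<le> g x"
    and gd: "distr P' S R = density (distr P S R) (\<lambda>x. ennreal (g x))"
    using exists_real_density[OF J.sigma_finite_measure_axioms J'.finite_measure_axioms] by auto
  have gS[measurable]: "g \<in> borel_measurable S" using g by simp
  have "(\<integral>\<^sup>+\<omega>. f (R \<omega>) \<partial>P') = (\<integral>\<^sup>+\<omega>. ennreal (g (R \<omega>)) * f (R \<omega>) \<partial>P)"
    if f[measurable]: "f \<in> borel_measurable S" for f
  proof -
    have "(\<integral>\<^sup>+\<omega>. f (R \<omega>) \<partial>P') = (\<integral>\<^sup>+x. f x \<partial>distr P' S R)"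
      by (subst nn_integral_distr) auto
    also have "\<dots> = (\<integral>\<^sup>+x. ennreal (g x) * f x \<partial>distr P S R)"
      unfolding gd by (rule nn_integral_density) auto
    also have "\<dots> = (\<integral>\<^sup>+\<omega>. ennreal (g (R \<omega>)) * f (R \<omega>) \<partial>P)"
      by (subst nn_integral_distr) auto
    finally show ?thesis .
  qed
  then show ?thesis
    using gS g0 unfolding is_image_density_def by blast
qed

text \<open>Over an event \<open>U \<in> B\<close> both \<open>w\<close> and
  \<open>m (U \<omega>)\<close> integrate to its \<open>P'\<close>-probability, which characterises
  a conditional expectation. This connects the image densities with the martingale lemma.\<close>

lemma real_cond_exp_vimage_eq_density:
  fixes w :: "'w \<Rightarrow> real" and m :: "'s \<Rightarrow> real"
  assumes P: "prob_space P" and P': "prob_space P'"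
    and U[measurable]: "U \<in> P \<rightarrow>\<^sub>M S"
    and w[measurable]: "w \<in> borel_measurable P" and w0: "\<And>\<omega>. 0 \<le> w \<omega>"
    and ew: "\<And>f. f \<in> borel_measurable S \<Longrightarrow> (\<integral>\<^sup>+\<omega>. f (U \<omega>) \<partial>P') = (\<integral>\<^sup>+\<omega>. ennreal (w \<omega>) * f (U \<omega>) \<partial>P)"
    and dm: "is_image_density P P' U S m"
  shows "subalgebra P (vimage_algebra (space P) U S)"
    and "integrable P w" and "integrable P (\<lambda>\<omega>. m (U \<omega>))"
    and "AE \<omega> in P. real_cond_exp P (vimage_algebra (space P) U S) w \<omega> = m (U \<omega>)"
proof -
  interpret P: prob_space P by fact
  interpret P': prob_space P' by fact
  note m[measurable] = image_densityD(1)[OF dm] and m0 = image_densityD(2)[OF dm] and em = image_densityD(3)[OF dm]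
  let ?F = "vimage_algebra (space P) U S"
  have Us: "U \<in> space P \<rightarrow> space S" using measurable_space[OF U] by auto
  show sub: "subalgebra P ?F"
    unfolding subalgebra_def using Us measurable_sets[OF U] by (auto simp: sets_vimage_algebra2)
  interpret finite_measure_subalgebra P ?F
    by (simp add: finite_measure_subalgebra_def finite_measure_subalgebra_axioms_def sub P.finite_measure_axioms)
  have one: "(\<integral>\<^sup>+\<omega>. ennreal (w \<omega>) \<partial>P) = 1" "(\<integral>\<^sup>+\<omega>. ennreal (m (U \<omega>)) \<partial>P) = 1"
    using ew[of "\<lambda>_. 1"] em[of "\<lambda>_. 1"] P'.emeasure_space_1 by simp_all
  show wi: "integrable P w" using one w0 by (intro integrableI_nonneg) auto
  show mi: "integrable P (\<lambda>\<omega>. m (U \<omega>))" using one m0 by (intro integrableI_nonneg) auto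
  show "AE \<omega> in P. real_cond_exp P ?F w \<omega> = m (U \<omega>)"
  proof (rule real_cond_exp_charact[OF _ wi mi])
    show "(\<lambda>\<omega>. m (U \<omega>)) \<in> borel_measurable ?F"
      by (rule measurable_compose[OF measurable_vimage_algebra1[OF Us] m])
    fix A assume "A \<in> sets ?F"
    then obtain B where B[measurable]: "B \<in> sets S" and A: "A = U -` B \<inter> space P"
      using Us by (auto simp: sets_vimage_algebra2)
    have i: "indicator A \<omega> = (indicator B (U \<omega>) :: real)" if "\<omega> \<in> space P" for \<omega>
      using that by (simp add: A indicator_def)
    have "(\<integral>\<omega>\<in>A. w \<omega> \<partial>P) = (\<integral>\<omega>. w \<omega> * indicator B (U \<omega>) \<partial>P)"
      unfolding set_lebesgue_integral_def using i by (intro Bochner_Integration.integral_cong) (auto simp: mult.commute)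
    also have "\<dots> = enn2real (\<integral>\<^sup>+\<omega>. ennreal (w \<omega>) * indicator B (U \<omega>) \<partial>P)"
      using w0 by (subst integral_eq_nn_integral) (auto simp: ennreal_mult' ennreal_indicator)
    also have "(\<integral>\<^sup>+\<omega>. ennreal (w \<omega>) * indicator B (U \<omega>) \<partial>P) = (\<integral>\<^sup>+\<omega>. ennreal (m (U \<omega>)) * indicator B (U \<omega>) \<partial>P)"
      using ew[of "indicator B"] em[of "indicator B"] by simp
    also have "enn2real \<dots> = (\<integral>\<omega>. m (U \<omega>) * indicator B (U \<omega>) \<partial>P)"
      using m0 by (subst integral_eq_nn_integral) (auto simp: ennreal_mult' ennreal_indicator)
    also have "\<dots> = (\<integral>\<omega>\<in>A. m (U \<omega>) \<partial>P)"
      unfolding set_lebesgue_integral_def using i by (intro Bochner_Integration.integral_cong) (auto simp: mult.commute)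
    finally show "(\<integral>\<omega>\<in>A. w \<omega> \<partial>P) = (\<integral>\<omega>\<in>A. m (U \<omega>) \<partial>P)" .
  qed
qed

theorem theorem6:
  fixes T :: "'x::polish_space \<Rightarrow> 'x measure"
    and Q :: "'z::polish_space measure"
    and h :: "'x \<Rightarrow> 'z \<Rightarrow> 'y::polish_space"
    and \<mu> \<nu> :: "'x measure"
    and X :: "nat \<Rightarrow> 'w \<Rightarrow> 'x" and Z :: "nat \<Rightarrow> 'w \<Rightarrow> 'z"
    and P\<mu> P\<nu> :: "'w measure"
    and F\<mu> F\<nu> G\<mu> G\<nu> :: "nat \<Rightarrow> (nat \<Rightarrow> 'y) \<Rightarrow> 'x measure"
  assumes T: "T \<in> borel \<rightarrow>\<^sub>M prob_algebra borel"
    and Q: "prob_space Q" "sets Q = sets borel"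
    and h: "(\<lambda>(x, z). h x z) \<in> borel \<rightarrow>\<^sub>M borel"
    and \<mu>: "prob_space \<mu>" "sets \<mu> = sets borel"
    and \<nu>: "prob_space \<nu>" "sets \<nu> = sets borel"
    and ac: "absolutely_continuous \<nu> \<mu>"
    and M\<mu>: "hmm_model P\<mu> \<mu> T Q X Z"
    and M\<nu>: "hmm_model P\<nu> \<nu> T Q X Z"
    and F\<mu>: "\<And>n. is_rcd P\<mu> X (\<lambda>i \<omega>. h (X i \<omega>) (Z i \<omega>)) n {..n} (F\<mu> n)"
    and F\<nu>: "\<And>n. is_rcd P\<nu> X (\<lambda>i \<omega>. h (X i \<omega>) (Z i \<omega>)) n {..n} (F\<nu> n)"
    and G\<mu>: "\<And>n. is_rcd P\<mu> X (\<lambda>i \<omega>. h (X i \<omega>) (Z i \<omega>)) n {..<n} (G\<mu> n)"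
    and G\<nu>: "\<And>n. is_rcd P\<nu> X (\<lambda>i \<omega>. h (X i \<omega>) (Z i \<omega>)) n {..<n} (G\<nu> n)"
  shows "(\<lambda>n. \<integral>\<omega>. tv_dist (F\<mu> n (\<lambda>i\<in>{..n}. h (X i \<omega>) (Z i \<omega>)))
                          (F\<nu> n (\<lambda>i\<in>{..n}. h (X i \<omega>) (Z i \<omega>))) \<partial>P\<mu>) \<longlonglongrightarrow> 0
     \<longleftrightarrow> (\<lambda>n. \<integral>\<omega>. tv_dist (G\<mu> n (\<lambda>i\<in>{..<n}. h (X i \<omega>) (Z i \<omega>)))
                          (G\<nu> n (\<lambda>i\<in>{..<n}. h (X i \<omega>) (Z i \<omega>))) \<partial>P\<mu>) \<longlonglongrightarrow> 0"
proof -
  define S where "S n = PiM {..<n} (\<lambda>_. borel :: 'y measure)" for n :: nat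
  \<comment> \<open>\<open>Y n\<close> holds the first \<open>n\<close> observations, those at times
    below \<open>n\<close>. The predictor at time \<open>n\<close> therefore conditions on
    \<open>Y n\<close>, and the filter on \<open>Y (Suc n)\<close>.\<close>
  define Y where "Y n \<omega> = (\<lambda>i\<in>{..<n}. h (X i \<omega>) (Z i \<omega>))" for n :: nat and \<omega>
  interpret P\<mu>: prob_space P\<mu> using M\<mu> by (simp add: hmm_model_def)
  interpret P\<nu>: prob_space P\<nu> using M\<nu> by (simp add: hmm_model_def)
  interpret \<mu>: prob_space \<mu> by fact
  interpret \<nu>: prob_space \<nu> by fact
  have X[measurable]: "X i \<in> P\<mu> \<rightarrow>\<^sub>M borel" "X i \<in> P\<nu> \<rightarrow>\<^sub>M borel" "Z i \<in> P\<mu> \<rightarrow>\<^sub>M borel" "Z i \<in> P\<nu> \<rightarrow>\<^sub>M borel" for i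
    using M\<mu> M\<nu> by (simp_all add: hmm_model_def)
  have h'[measurable]: "(\<lambda>w. h (f w) (k w)) \<in> M \<rightarrow>\<^sub>M borel"
    if "f \<in> M \<rightarrow>\<^sub>M borel" "k \<in> M \<rightarrow>\<^sub>M borel" for M :: "'v measure" and f k
    using measurable_compose[OF borel_measurable_Pair[OF that] h] by simp
  have hX[measurable]: "(\<lambda>\<omega>. h (X i \<omega>) (Z i \<omega>)) \<in> P\<mu> \<rightarrow>\<^sub>M borel" "(\<lambda>\<omega>. h (X i \<omega>) (Z i \<omega>)) \<in> P\<nu> \<rightarrow>\<^sub>M borel" for i
    by (rule measurable_compose[OF borel_measurable_Pair h, simplified]; simp)+
  have Y[measurable]: "Y n \<in> P\<mu> \<rightarrow>\<^sub>M S n" "Y n \<in> P\<nu> \<rightarrow>\<^sub>M S n" for n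
    unfolding Y_def S_def by (intro measurable_restrict; simp)+

  obtain \<Lambda> :: "'x \<Rightarrow> real" where \<Lambda>': "\<Lambda> \<in> borel_measurable \<nu>" and \<Lambda>0: "\<And>x. 0 \<le> \<Lambda> x"
    and \<Lambda>d: "\<mu> = density \<nu> (\<lambda>x. ennreal (\<Lambda> x))"
    using exists_real_density[OF \<nu>.sigma_finite_measure_axioms \<mu>.finite_measure_axioms ac] \<mu> \<nu> by auto
  have \<Lambda>[measurable]: "\<Lambda> \<in> borel_measurable borel"
    using \<Lambda>' measurable_cong_sets[OF \<nu>(2) refl] by blast

  let ?X = "PiM UNIV (\<lambda>_::nat. borel :: 'x measure)" and ?Z = "PiM UNIV (\<lambda>_::nat. borel :: 'z measure)"
  let ?Zn = "\<lambda>n. PiM {..<n} (\<lambda>_. borel :: 'z measure)"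
  \<comment> \<open>Writes the current state and the past observations in terms of the path and the
    noise strictly before \<open>n\<close>; leaving out \<open>Z n\<close> is what permits
    \<open>hmm_noise_independent\<close> below.\<close>
  define \<psi> where "\<psi> n = (\<lambda>(x :: nat \<Rightarrow> 'x, z :: nat \<Rightarrow> 'z). (x n, \<lambda>i\<in>{..<n}. h (x i) (z i)))" for n :: nat
  have \<psi>[measurable]: "\<psi> n \<in> ?X \<Otimes>\<^sub>M ?Zn n \<rightarrow>\<^sub>M borel \<Otimes>\<^sub>M S n" for n
  proof -
    have "(\<lambda>w. h (fst w i) (snd w i)) \<in> ?X \<Otimes>\<^sub>M ?Zn n \<rightarrow>\<^sub>M borel" if i: "i \<in> {..<n}" for i
    proof (rule h')
      show "(\<lambda>w. fst w i) \<in> ?X \<Otimes>\<^sub>M ?Zn n \<rightarrow>\<^sub>M borel" by measurable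
      show "(\<lambda>w. snd w i) \<in> ?X \<Otimes>\<^sub>M ?Zn n \<rightarrow>\<^sub>M borel"
        by (rule measurable_compose[OF measurable_snd measurable_component_singleton[OF i]])
    qed
    then show ?thesis
      unfolding \<psi>_def S_def case_prod_beta'
      by (intro measurable_Pair measurable_restrict) measurable
  qed
  have \<psi>_eq: "\<psi> n (\<lambda>i. X i \<omega>, \<lambda>i\<in>{..<n}. Z i \<omega>) = (X n \<omega>, Y n \<omega>)" for n \<omega>
    by (auto simp: \<psi>_def Y_def)
  have rs[measurable]: "(\<lambda>z. \<lambda>i\<in>{..<n}. z i) \<in> ?Z \<rightarrow>\<^sub>M ?Zn n" for n
    by (intro measurable_restrict) simp
  have chg: "(\<integral>\<^sup>+\<omega>. f (X n \<omega>, Y n \<omega>) \<partial>P\<mu>) = (\<integral>\<^sup>+\<omega>. ennreal (\<Lambda> (X 0 \<omega>)) * f (X n \<omega>, Y n \<omega>) \<partial>P\<nu>)"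
    if [measurable]: "f \<in> borel_measurable (borel \<Otimes>\<^sub>M S n)" for f n
    using hmm_change_of_measure[OF T M\<mu> M\<nu> \<Lambda> \<Lambda>d, of "\<lambda>(x, z). f (\<psi> n (x, \<lambda>i\<in>{..<n}. z i))"]
    by (simp add: \<psi>_eq)

  have w: "(\<lambda>\<omega>. ennreal (\<Lambda> (X 0 \<omega>))) \<in> borel_measurable P\<nu>" by measurable
  have R: "(\<lambda>\<omega>. (X n \<omega>, Y n \<omega>)) \<in> P\<nu> \<rightarrow>\<^sub>M borel \<Otimes>\<^sub>M S n" "(\<lambda>\<omega>. (X n \<omega>, Y n \<omega>)) \<in> P\<mu> \<rightarrow>\<^sub>M borel \<Otimes>\<^sub>M S n" for n
    by (intro measurable_Pair X Y)+
  \<comment> \<open>\<open>g n\<close> plays the role of the \<nu>-conditional expectation of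
    \<open>\<Lambda> (X 0 \<omega>)\<close> given \<open>(X n, Y n)\<close>, and \<open>m n\<close>
    below that given \<open>Y n\<close>.\<close>
  obtain g :: "nat \<Rightarrow> _ \<Rightarrow> real" where g': "\<And>n. is_image_density P\<nu> P\<mu> (\<lambda>\<omega>. (X n \<omega>, Y n \<omega>)) (borel \<Otimes>\<^sub>M S n) (g n)"
    using exists_image_density[OF P\<nu>.prob_space_axioms P\<mu>.prob_space_axioms R w chg] by metis
  note g[measurable] = image_densityD(1)[OF g'] and g0 = image_densityD(2)[OF g'] and gd = image_densityD(3)[OF g']
  have chgY: "(\<integral>\<^sup>+\<omega>. f (Y n \<omega>) \<partial>P\<mu>) = (\<integral>\<^sup>+\<omega>. ennreal (\<Lambda> (X 0 \<omega>)) * f (Y n \<omega>) \<partial>P\<nu>)"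
    if "f \<in> borel_measurable (S n)" for f n
    using chg[of "\<lambda>z. f (snd z)" n] that by simp
  obtain m :: "nat \<Rightarrow> _ \<Rightarrow> real" where m': "\<And>n. is_image_density P\<nu> P\<mu> (Y n) (S n) (m n)"
    using exists_image_density[OF P\<nu>.prob_space_axioms P\<mu>.prob_space_axioms Y(2,1) w chgY] by metis
  note m[measurable] = image_densityD(1)[OF m'] and m0 = image_densityD(2)[OF m'] and md = image_densityD(3)[OF m']

  have pred: "(\<integral>\<omega>. tv_dist (G\<mu> n (Y n \<omega>)) (G\<nu> n (Y n \<omega>)) \<partial>P\<mu>) = (\<integral>\<omega>. \<bar>g n (X n \<omega>, Y n \<omega>) - m n (Y n \<omega>)\<bar> \<partial>P\<nu>)" for n
  proof (rule integral_tv_dist_cond_kernels[OF P\<nu>.prob_space_axioms P\<mu>.prob_space_axioms _ _ g' m'])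
    show "cond_kernel P\<nu> borel (X n) (S n) (Y n) (G\<nu> n)" "cond_kernel P\<mu> borel (X n) (S n) (Y n) (G\<mu> n)"
      using is_rcd_imp_cond_kernel[OF G\<nu>[of n]] is_rcd_imp_cond_kernel[OF G\<mu>[of n]]
      unfolding S_def Y_def by auto
  qed

  have restr[measurable]: "(\<lambda>y. \<lambda>i\<in>{..<n}. y i) \<in> S (Suc n) \<rightarrow>\<^sub>M S n" for n
    unfolding S_def by (intro measurable_restrict measurable_component_singleton) auto
  have Yr: "(\<lambda>i\<in>{..<n}. Y (Suc n) \<omega> i) = Y n \<omega>" for n \<omega>
    by (auto simp: Y_def)

  \<comment> \<open>\<open>Y\<^sub>n\<close> is a function of \<open>X\<^sub>n\<close> and of the noise \<open>Z\<^sub>n\<close>, which is independent of \<open>(X\<^sub>n, Y\<^sub>0, \<dots>, Y\<^sub>n\<^sub>-\<^sub>1)\<close> under both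
    measures; hence observing it leaves the density \<open>g n\<close> unchanged.\<close>
  have gfilt: "(\<integral>\<^sup>+\<omega>. f (X n \<omega>, Y (Suc n) \<omega>) \<partial>P\<mu>)
      = (\<integral>\<^sup>+\<omega>. ennreal (g n (X n \<omega>, Y n \<omega>)) * f (X n \<omega>, Y (Suc n) \<omega>) \<partial>P\<nu>)"
    if f[measurable]: "f \<in> borel_measurable (borel \<Otimes>\<^sub>M S (Suc n))" for f n
  proof -
    let ?B = "borel \<Otimes>\<^sub>M (borel \<Otimes>\<^sub>M S n) :: ('z \<times> 'x \<times> (nat \<Rightarrow> 'y)) measure"
    \<comment> \<open>\<open>Y (Suc n)\<close> is \<open>Y n\<close> with
      \<open>h (X n \<omega>) (Z n \<omega>)\<close> entered at index \<open>n\<close>, so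
      \<open>f\<close> becomes a function of \<open>Z n\<close> and of the pair
      \<open>(X n, Y n)\<close>.\<close>
    define u where "u w = f (fst (snd w), (snd (snd w))(n := h (fst (snd w)) (fst w)))" for w
    have "(\<lambda>w. (snd (snd w))(n := h (fst (snd w)) (fst w))) \<in> ?B \<rightarrow>\<^sub>M S (Suc n)"
      unfolding S_def lessThan_Suc
      by (rule measurable_fun_upd[of _ "{..<n}" n]) (auto intro!: h')
    then have [measurable]: "u \<in> borel_measurable ?B"
      unfolding u_def by measurable
    have fu: "f (X n \<omega>, Y (Suc n) \<omega>) = u (Z n \<omega>, X n \<omega>, Y n \<omega>)" for \<omega>
      unfolding u_def Y_def by (auto intro!: arg_cong[where f=f])
    have ck: "cond_kernel P\<mu> borel (Z n) (borel \<Otimes>\<^sub>M S n) (\<lambda>\<omega>. (X n \<omega>, Y n \<omega>)) (\<lambda>_. Q)"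
      "cond_kernel P\<nu> borel (Z n) (borel \<Otimes>\<^sub>M S n) (\<lambda>\<omega>. (X n \<omega>, Y n \<omega>)) (\<lambda>_. Q)"
      using hmm_noise_independent[OF M\<mu> \<psi>[of n]] hmm_noise_independent[OF M\<nu> \<psi>[of n]] by (simp_all add: \<psi>_eq)
    have Qk: "(\<lambda>_. Q) \<in> ((borel :: 'x measure) \<Otimes>\<^sub>M S n) \<rightarrow>\<^sub>M prob_algebra borel"
      using ck by (simp add: cond_kernel_def)
    have um: "(\<lambda>v. \<integral>\<^sup>+z. u (z, v) \<partial>Q) \<in> borel_measurable (borel \<Otimes>\<^sub>M S n)"
      by (rule nn_integral_kernel_measurable[OF Qk]) simp
    have "(\<integral>\<^sup>+\<omega>. f (X n \<omega>, Y (Suc n) \<omega>) \<partial>P\<mu>) = (\<integral>\<^sup>+\<omega>. \<integral>\<^sup>+z. u (z, X n \<omega>, Y n \<omega>) \<partial>Q \<partial>P\<mu>)"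
      unfolding fu by (rule nn_integral_disintegration[OF P\<mu>.prob_space_axioms ck(1)]) simp
    \<comment> \<open>Once \<open>Z n\<close> is averaged out, what remains is a function of
      \<open>(X n, Y n)\<close>, to which the density \<open>g n\<close> applies.\<close>
    also have "\<dots> = (\<integral>\<^sup>+\<omega>. ennreal (g n (X n \<omega>, Y n \<omega>)) * (\<integral>\<^sup>+z. u (z, X n \<omega>, Y n \<omega>) \<partial>Q) \<partial>P\<nu>)"
      by (rule gd[OF um])
    also have "\<dots> = (\<integral>\<^sup>+\<omega>. \<integral>\<^sup>+z. ennreal (g n (X n \<omega>, Y n \<omega>)) * u (z, X n \<omega>, Y n \<omega>) \<partial>Q \<partial>P\<nu>)"
    proof (rule nn_integral_cong)
      fix \<omega> assume "\<omega> \<in> space P\<nu>"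
      then have "Y n \<omega> \<in> space (S n)" using measurable_space[OF Y(2)] by blast
      then have "(\<lambda>z. u (z, X n \<omega>, Y n \<omega>)) \<in> borel_measurable Q"
        unfolding measurable_cong_sets[OF Q(2) refl] by measurable
      then show "ennreal (g n (X n \<omega>, Y n \<omega>)) * (\<integral>\<^sup>+z. u (z, X n \<omega>, Y n \<omega>) \<partial>Q)
        = (\<integral>\<^sup>+z. ennreal (g n (X n \<omega>, Y n \<omega>)) * u (z, X n \<omega>, Y n \<omega>) \<partial>Q)"
        by (simp add: nn_integral_cmult)
    qed
    also have "\<dots> = (\<integral>\<^sup>+\<omega>. ennreal (g n (X n \<omega>, Y n \<omega>)) * f (X n \<omega>, Y (Suc n) \<omega>) \<partial>P\<nu>)"
      unfolding fu
      using nn_integral_disintegration[OF P\<nu>.prob_space_axioms ck(2), of "\<lambda>(z, v). ennreal (g n v) * u (z, v)"] by simp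
    finally show ?thesis .
  qed

  have filt: "(\<integral>\<omega>. tv_dist (F\<mu> n (Y (Suc n) \<omega>)) (F\<nu> n (Y (Suc n) \<omega>)) \<partial>P\<mu>)
      = (\<integral>\<omega>. \<bar>g n (X n \<omega>, Y n \<omega>) - m (Suc n) (Y (Suc n) \<omega>)\<bar> \<partial>P\<nu>)" for n
  proof -
    \<comment> \<open>The density for the filter has to be a function of
      \<open>(X n, Y (Suc n))\<close>. It is \<open>g n\<close> after the newest observation is
      discarded.\<close>
    let ?g = "\<lambda>v. g n (fst v, \<lambda>i\<in>{..<n}. snd v i)"
    have "(\<integral>\<omega>. tv_dist (F\<mu> n (Y (Suc n) \<omega>)) (F\<nu> n (Y (Suc n) \<omega>)) \<partial>P\<mu>)
      = (\<integral>\<omega>. \<bar>?g (X n \<omega>, Y (Suc n) \<omega>) - m (Suc n) (Y (Suc n) \<omega>)\<bar> \<partial>P\<nu>)"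
    proof (rule integral_tv_dist_cond_kernels[OF P\<nu>.prob_space_axioms P\<mu>.prob_space_axioms _ _ _ m'])
      show "cond_kernel P\<nu> borel (X n) (S (Suc n)) (Y (Suc n)) (F\<nu> n)" "cond_kernel P\<mu> borel (X n) (S (Suc n)) (Y (Suc n)) (F\<mu> n)"
        using is_rcd_imp_cond_kernel[OF F\<nu>[of n]] is_rcd_imp_cond_kernel[OF F\<mu>[of n]]
        unfolding S_def Y_def lessThan_Suc_atMost by auto
      have "?g \<in> borel_measurable (borel \<Otimes>\<^sub>M S (Suc n))"
        using measurable_compose[OF measurable_Pair[OF measurable_fst measurable_compose[OF measurable_snd restr]] g] by simp
      then show "is_image_density P\<nu> P\<mu> (\<lambda>\<omega>. (X n \<omega>, Y (Suc n) \<omega>)) (borel \<Otimes>\<^sub>M S (Suc n)) ?g"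
        unfolding is_image_density_def using gfilt[of _ n] g0 by (simp only: fst_conv snd_conv Yr) blast
    qed
    then show ?thesis by (simp only: fst_conv snd_conv Yr)
  qed

  have L0: "(\<lambda>\<omega>. \<Lambda> (X 0 \<omega>)) \<in> borel_measurable P\<nu>" by simp
  define \<F> where "\<F> n = vimage_algebra (space P\<nu>) (Y n) (S n)" for n
  have sub: "subalgebra P\<nu> (\<F> n)" and Li: "integrable P\<nu> (\<lambda>\<omega>. \<Lambda> (X 0 \<omega>))" and mi: "integrable P\<nu> (\<lambda>\<omega>. m n (Y n \<omega>))"
    and ce_eq: "AE \<omega> in P\<nu>. real_cond_exp P\<nu> (\<F> n) (\<lambda>\<omega>. \<Lambda> (X 0 \<omega>)) \<omega> = m n (Y n \<omega>)" for n
    by (rule real_cond_exp_vimage_eq_density[OF P\<nu>.prob_space_axioms P\<mu>.prob_space_axioms Y(2)[of n] L0 \<Lambda>0 _ m'[of n], folded \<F>_def],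
        erule chgY)+
  have mart: "(\<lambda>n. \<integral>\<omega>. \<bar>m (Suc n) (Y (Suc n) \<omega>) - m n (Y n \<omega>)\<bar> \<partial>P\<nu>) \<longlonglongrightarrow> 0"
  proof -
    have "(\<lambda>n. \<integral>\<omega>. \<bar>real_cond_exp P\<nu> (\<F> (Suc n)) (\<lambda>\<omega>. \<Lambda> (X 0 \<omega>)) \<omega> - real_cond_exp P\<nu> (\<F> n) (\<lambda>\<omega>. \<Lambda> (X 0 \<omega>)) \<omega>\<bar> \<partial>P\<nu>) \<longlonglongrightarrow> 0"
    proof (rule P\<nu>.closed_martingale_increments)
      show "subalgebra P\<nu> (\<F> n)" for n by (rule sub)
      show "integrable P\<nu> (\<lambda>\<omega>. \<Lambda> (X 0 \<omega>))" by (rule Li)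
      show "sets (\<F> n) \<subseteq> sets (\<F> (Suc n))" for n
      proof
        have Us: "Y n \<in> space P\<nu> \<rightarrow> space (S n)" for n using measurable_space[OF Y(2)] by auto
        fix A assume "A \<in> sets (\<F> n)"
        then obtain B where B: "B \<in> sets (S n)" and A: "A = Y n -` B \<inter> space P\<nu>"
          unfolding \<F>_def sets_vimage_algebra2[OF Us] by auto
        have "(\<lambda>y. \<lambda>i\<in>{..<n}. y i) -` B \<inter> space (S (Suc n)) \<in> sets (S (Suc n))"
          by (rule measurable_sets[OF restr B])
        moreover have "A = Y (Suc n) -` ((\<lambda>y. \<lambda>i\<in>{..<n}. y i) -` B \<inter> space (S (Suc n))) \<inter> space P\<nu>"
          unfolding A using Us[of "Suc n"] by (auto simp: Yr Pi_iff)
        ultimately show "A \<in> sets (\<F> (Suc n))"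
          unfolding \<F>_def sets_vimage_algebra2[OF Us] by blast
      qed
    qed
    moreover have "(\<integral>\<omega>. \<bar>real_cond_exp P\<nu> (\<F> (Suc n)) (\<lambda>\<omega>. \<Lambda> (X 0 \<omega>)) \<omega> - real_cond_exp P\<nu> (\<F> n) (\<lambda>\<omega>. \<Lambda> (X 0 \<omega>)) \<omega>\<bar> \<partial>P\<nu>)
      = (\<integral>\<omega>. \<bar>m (Suc n) (Y (Suc n) \<omega>) - m n (Y n \<omega>)\<bar> \<partial>P\<nu>)" for n
    proof (rule integral_cong_AE)
      show "AE \<omega> in P\<nu>. \<bar>real_cond_exp P\<nu> (\<F> (Suc n)) (\<lambda>\<omega>. \<Lambda> (X 0 \<omega>)) \<omega> - real_cond_exp P\<nu> (\<F> n) (\<lambda>\<omega>. \<Lambda> (X 0 \<omega>)) \<omega>\<bar>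
        = \<bar>m (Suc n) (Y (Suc n) \<omega>) - m n (Y n \<omega>)\<bar>"
        using ce_eq[of n] ce_eq[of "Suc n"] by eventually_elim simp
    qed simp_all
    ultimately show ?thesis by simp
  qed

  \<comment> \<open>The filter and predictor integrals share the term
    \<open>g n (X n \<omega>, Y n \<omega>)\<close>. The reverse triangle inequality cancels it and
    leaves a martingale increment.\<close>
  have abs3: "\<bar>\<bar>x - y\<bar> - \<bar>x - z\<bar>\<bar> \<le> \<bar>y - z\<bar>" for x y z :: real
    using abs_triangle_ineq3[of "x - y" "x - z"] by (simp add: abs_minus_commute)
  define a where "a n = (\<integral>\<omega>. \<bar>g n (X n \<omega>, Y n \<omega>) - m (Suc n) (Y (Suc n) \<omega>)\<bar> \<partial>P\<nu>)" for n
  define b where "b n = (\<integral>\<omega>. \<bar>g n (X n \<omega>, Y n \<omega>) - m n (Y n \<omega>)\<bar> \<partial>P\<nu>)" for n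
  have "\<bar>a n - b n\<bar> \<le> (\<integral>\<omega>. \<bar>m (Suc n) (Y (Suc n) \<omega>) - m n (Y n \<omega>)\<bar> \<partial>P\<nu>)" for n
  proof -
    \<comment> \<open>Testing the density with the constant 1 gives the total mass of
      \<open>P\<mu>\<close>. The resulting integrability lets \<open>a n - b n\<close> be written as
      one integral.\<close>
    have "(\<integral>\<^sup>+\<omega>. ennreal (g n (X n \<omega>, Y n \<omega>)) \<partial>P\<nu>) = 1"
      using gd[of "\<lambda>_. 1" n] P\<mu>.emeasure_space_1 by simp
    then have gi: "integrable P\<nu> (\<lambda>\<omega>. g n (X n \<omega>, Y n \<omega>))"
      using g0 by (intro integrableI_nonneg) auto
    note i = gi mi[of n] mi[of "Suc n"]
    have eq: "a n - b n = (\<integral>\<omega>. \<bar>g n (X n \<omega>, Y n \<omega>) - m (Suc n) (Y (Suc n) \<omega>)\<bar> - \<bar>g n (X n \<omega>, Y n \<omega>) - m n (Y n \<omega>)\<bar> \<partial>P\<nu>)"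
      unfolding a_def b_def using i by simp
    have "\<bar>a n - b n\<bar> \<le> (\<integral>\<omega>. \<bar>\<bar>g n (X n \<omega>, Y n \<omega>) - m (Suc n) (Y (Suc n) \<omega>)\<bar> - \<bar>g n (X n \<omega>, Y n \<omega>) - m n (Y n \<omega>)\<bar>\<bar> \<partial>P\<nu>)"
      unfolding eq by (rule integral_abs_bound)
    also have "\<dots> \<le> (\<integral>\<omega>. \<bar>m (Suc n) (Y (Suc n) \<omega>) - m n (Y n \<omega>)\<bar> \<partial>P\<nu>)"
    proof (rule integral_mono)
      show "\<bar>\<bar>g n (X n \<omega>, Y n \<omega>) - m (Suc n) (Y (Suc n) \<omega>)\<bar> - \<bar>g n (X n \<omega>, Y n \<omega>) - m n (Y n \<omega>)\<bar>\<bar>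
        \<le> \<bar>m (Suc n) (Y (Suc n) \<omega>) - m n (Y n \<omega>)\<bar>" for \<omega>
        by (rule abs3)
    qed (use i in \<open>simp_all only: integrable_abs Bochner_Integration.integrable_diff\<close>)
    finally show ?thesis .
  qed
  then have ab: "(\<lambda>n. a n - b n) \<longlonglongrightarrow> 0"
    by (intro Lim_null_comparison[OF always_eventually mart]) simp
  have "a \<longlonglongrightarrow> 0 \<longleftrightarrow> b \<longlonglongrightarrow> 0"
  proof
    show "a \<longlonglongrightarrow> 0 \<Longrightarrow> b \<longlonglongrightarrow> 0" using tendsto_diff[OF _ ab, of a 0] by simp
    show "b \<longlonglongrightarrow> 0 \<Longrightarrow> a \<longlonglongrightarrow> 0" using tendsto_add[OF ab, of b 0] by simp
  qed
  moreover have "a = (\<lambda>n. \<integral>\<omega>. tv_dist (F\<mu> n (\<lambda>i\<in>{..n}. h (X i \<omega>) (Z i \<omega>)))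
                          (F\<nu> n (\<lambda>i\<in>{..n}. h (X i \<omega>) (Z i \<omega>))) \<partial>P\<mu>)"
    by (rule ext) (simp only: a_def filt[symmetric], simp only: Y_def lessThan_Suc_atMost)
  moreover have "b = (\<lambda>n. \<integral>\<omega>. tv_dist (G\<mu> n (\<lambda>i\<in>{..<n}. h (X i \<omega>) (Z i \<omega>)))
                          (G\<nu> n (\<lambda>i\<in>{..<n}. h (X i \<omega>) (Z i \<omega>))) \<partial>P\<mu>)"
    by (rule ext) (simp only: b_def pred[symmetric], simp only: Y_def)
  ultimately show ?thesis by (simp only:)
qed

end
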